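(* Let $d\ge1$, $n\ge2$, let $X=\{x_1,\dots,x_n\}\subset\mathbb{R}^d$ be distinct points, $m\colon\mathbb{R}^d\to\mathbb{R}$ a function and $Y=(y_1,\dots,y_n)\in\mathbb{R}^n$. Let $K(x,y)=\Phi(x-y)$, $x,y\in\mathbb{R}^d$, be a positive-definite kernel, where $\Phi\colon\mathbb{R}^d\to\mathbb{R}$ is continuous and integrable and there are constants $C_1,C_2>0$ and $\alpha>d/2$ such that $C_1(1+\|\xi\|^2)^{-\alpha}\le\widehat\Phi(\xi)\le C_2(1+\|\xi\|^2)^{-\alpha}$ for all $\xi\in\mathbb{R}^d$. For $\lambda>0$ let $K_\lambda(x,y)=\Phi((x-y)/\lambda)$ and define the leave-one-out cross-validation objective $$\ell_{\mathrm{CV}}(\lambda\mid Y)=\sum_{k=1}^n\bigg[\bigg(\frac{y_k-\mu_{\lambda,n,k}(x_k)}{P_{\lambda,n,k}(x_k)}\bigg)^2+\log\big[P_{\lambda,n,k}(x_k)^2\big]\bigg],$$ where $\mu_{\lambda,n,k}$ and $P_{\lambda,n,k}$ are the conditional mean and standard deviation functions for the kernel $K_\lambda$ based on the data at $X\setminus\{x_k\}$. Let $\lambda_{\mathrm{CV}}\in\arg\min_{\lambda>0}\ell_{\mathrm{CV}}(\lambda\mid Y)$. If $Y$ is $m$-constant, i.e. there is $c\in\mathbb{R}$ with $y_i-m(x_i)=c$ for all $i$, then $$\lim_{\lambda\to\infty}\ell_{\mathrm{CV}}(\lambda\mid Y)=-\infty\quad\text{and}\quad\lambda_{\mathrm{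CV}}=\infty.$$
   Context: A kernel is a symmetric function $K\colon\mathbb{R}^d\times\mathbb{R}^d\to\mathbb{R}$; it is (strictly) positive-definite if $\sum_{i,j}a_ia_jK(z_i,z_j)>0$ for all $N\in\mathbb{N}$, all non-zero $a\in\mathbb{R}^N$ and all distinct $z_1,\dots,z_N$. The Fourier transform is $\widehat f(\xi)=\int_{\mathbb{R}^d}f(x)e^{-\mathrm{i}\xi^{\mathsf T}x}\,dx$. With $X_{n,k}=X\setminus\{x_k\}$, $Y_{m,n,k}=(y_i-m(x_i))_{i\ne k}\in\mathbb{R}^{n-1}$, $K_\lambda(X_{n,k},X_{n,k})=(K_\lambda(x_i,x_j))_{i,j\neq k}$ and $K_\lambda(x,X_{n,k})=(K_\lambda(x,x_i))_{i\ne k}$, $$\mu_{\lambda,n,k}(x)=m(x)+K_\lambda(x,X_{n,k})^{\mathsf T}K_\lambda(X_{n,k},X_{n,k})^{-1}Y_{m,n,k},$$ $$P_{\lambda,n,k}(x)^2=K_\lambda(x,x)-K_\lambda(x,X_{n,k})^{\mathsf T}K_\lambda(X_{n,k},X_{n,k})^{-1}K_\lambda(x,X_{n,k}),$$ with $P_{\lambda,n,k}\ge0$. Convention: $\lambda_{\mathrm{CV}}=\infty$ means that every sequence $(\lambda_j)$ in $(0,\infty)$ with $\ell_{\mathrm{CV}}(\lambda_j\mid Y)\to\inf_{\lambda>0}\ell_{\mathrm{CV}}(\lambda\mid Y)$ satisfies $\lambda_j\to\infty$. *)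

theory Defs
  imports "HOL-Analysis.Analysis" "Jordan_Normal_Form.Determinant"
    "Jordan_Normal_Form.Gauss_Jordan_Elimination"
begin

section \<open>Kernels and the Fourier transform\<close>

definition positive_definite_kernel :: "('a \<Rightarrow> 'a \<Rightarrow> real) \<Rightarrow> bool" where
  "positive_definite_kernel K \<longleftrightarrow>
     (\<forall>x y. K x y = K y x) \<and>
     (\<forall>N (a :: nat \<Rightarrow> real) z. (\<exists>i<N. a i \<noteq> 0) \<longrightarrow> inj_on z {..<N} \<longrightarrow>
        (\<Sum>i<N. \<Sum>j<N. a i * a j * K (z i) (z j)) > 0)"

definition translation_kernel :: "(real ^ 'd \<Rightarrow> real) \<Rightarrow> real ^ 'd \<Rightarrow> real ^ 'd \<Rightarrow> real" where
  "translation_kernel \<Phi> x y = \<Phi> (x - y)"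

definition scaled_kernel :: "(real ^ 'd \<Rightarrow> real) \<Rightarrow> real \<Rightarrow> real ^ 'd \<Rightarrow> real ^ 'd \<Rightarrow> real" where
  "scaled_kernel \<Phi> l x y = \<Phi> ((x - y) /\<^sub>R l)"

definition fourier_transform :: "(real ^ 'd \<Rightarrow> real) \<Rightarrow> real ^ 'd \<Rightarrow> complex" where
  "fourier_transform f \<xi> =
     (LINT x|lborel. complex_of_real (f x) * exp (- (\<i> * complex_of_real (inner \<xi> x))))"


section \<open>Conditional mean and standard deviation\<close>

text \<open>
  A data set of \<open>N\<close> points consists of sites \<open>x 0, \<dots>, x (N - 1)\<close> and values
  \<open>y 0, \<dots>, y (N - 1)\<close>; the values of \<open>x\<close> and \<open>y\<close> at indices \<open>\<ge> N\<close> are irrelevant.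
\<close>

definition kernel_matrix :: "('a \<Rightarrow> 'a \<Rightarrow> real) \<Rightarrow> nat \<Rightarrow> (nat \<Rightarrow> 'a) \<Rightarrow> real mat" where
  "kernel_matrix K N x = mat N N (\<lambda>(i, j). K (x i) (x j))"

definition kernel_vector :: "('a \<Rightarrow> 'a \<Rightarrow> real) \<Rightarrow> nat \<Rightarrow> (nat \<Rightarrow> 'a) \<Rightarrow> 'a \<Rightarrow> real Matrix.vec" where
  "kernel_vector K N x z = Matrix.vec N (\<lambda>i. K z (x i))"

text \<open>
  \<^const>\<open>mat_inverse\<close> is option-valued. It is \<open>Some\<close> of the inverse on kernel matrices of
  positive-definite kernels at distinct sites.
\<close>

definition kernel_matrix_inv :: "('a \<Rightarrow> 'a \<Rightarrow> real) \<Rightarrow> nat \<Rightarrow> (nat \<Rightarrow> 'a) \<Rightarrow> real mat" where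
  "kernel_matrix_inv K N x = the (mat_inverse (kernel_matrix K N x))"

definition cond_mean ::
    "('a \<Rightarrow> real) \<Rightarrow> ('a \<Rightarrow> 'a \<Rightarrow> real) \<Rightarrow> nat \<Rightarrow> (nat \<Rightarrow> 'a) \<Rightarrow> (nat \<Rightarrow> real) \<Rightarrow> 'a \<Rightarrow> real" where
  "cond_mean m K N x y z =
     m z + scalar_prod (kernel_vector K N x z)
             (kernel_matrix_inv K N x *\<^sub>v Matrix.vec N (\<lambda>i. y i - m (x i)))"

definition cond_sd :: "('a \<Rightarrow> 'a \<Rightarrow> real) \<Rightarrow> nat \<Rightarrow> (nat \<Rightarrow> 'a) \<Rightarrow> 'a \<Rightarrow> real" where
  "cond_sd K N x z =
     sqrt (K z z - scalar_prod (kernel_vector K N x z)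
                     (kernel_matrix_inv K N x *\<^sub>v kernel_vector K N x z))"


section \<open>Leave-one-out cross-validation\<close>

text \<open>
  \<^term>\<open>insert_index k\<close> is the increasing enumeration of the natural numbers other than \<open>k\<close>, so
  for \<open>k < n\<close> the sites \<open>(x \<circ> insert_index k) i\<close> with \<open>i < n - 1\<close> are those \<open>x j\<close>
  with \<open>j < n\<close> and \<open>j \<noteq> k\<close>.
\<close>

definition loo_mean ::
    "('a \<Rightarrow> real) \<Rightarrow> ('a \<Rightarrow> 'a \<Rightarrow> real) \<Rightarrow> nat \<Rightarrow> (nat \<Rightarrow> 'a) \<Rightarrow> (nat \<Rightarrow> real) \<Rightarrow> nat \<Rightarrow> 'a \<Rightarrow> real" where
  "loo_mean m K n x y k = cond_mean m K (n - 1) (x \<circ> insert_index k) (y \<circ> insert_index k)"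

definition loo_sd :: "('a \<Rightarrow> 'a \<Rightarrow> real) \<Rightarrow> nat \<Rightarrow> (nat \<Rightarrow> 'a) \<Rightarrow> nat \<Rightarrow> 'a \<Rightarrow> real" where
  "loo_sd K n x k = cond_sd K (n - 1) (x \<circ> insert_index k)"

definition cv_objective ::
    "(real ^ 'd \<Rightarrow> real) \<Rightarrow> (real ^ 'd \<Rightarrow> real) \<Rightarrow> nat \<Rightarrow> (nat \<Rightarrow> real ^ 'd) \<Rightarrow> (nat \<Rightarrow> real) \<Rightarrow> real \<Rightarrow> real"
  where
  "cv_objective \<Phi> m n x y l =
     (\<Sum>k<n. ((y k - loo_mean m (scaled_kernel \<Phi> l) n x y k (x k))
                / loo_sd (scaled_kernel \<Phi> l) n x k (x k))\<^sup>2
            + ln ((loo_sd (scaled_kernel \<Phi> l) n x k (x k))\<^sup>2))"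

definition m_constant :: "('a \<Rightarrow> real) \<Rightarrow> nat \<Rightarrow> (nat \<Rightarrow> 'a) \<Rightarrow> (nat \<Rightarrow> real) \<Rightarrow> bool" where
  "m_constant m n x y \<longleftrightarrow> (\<exists>c. \<forall>i<n. y i - m (x i) = c)"

text \<open>
  The convention for an argument of the minimum over \<open>(0, \<infinity>)\<close> being \<open>\<infinity>\<close>. The infimum is taken
  in the extended reals because it may be \<open>-\<infinity>\<close>.
\<close>

definition argmin_is_infinity :: "(real \<Rightarrow> real) \<Rightarrow> bool" where
  "argmin_is_infinity f \<longleftrightarrow>
     (\<forall>l :: nat \<Rightarrow> real. (\<forall>j. l j > 0) \<longrightarrow>
        (\<lambda>j. ereal (f (l j))) \<longlonglongrightarrow> (INF t\<in>{0<..}. ereal (f t)) \<longrightarrow>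
        filterlim l at_top sequentially)"

end

theory Submission
  imports Defs "HOL-Probability.Characteristic_Functions" "HOL-Probability.Sinc_Integral"
begin

text \<open>
  Everything rests on one estimate. Let \<open>g\<close> be a bump function, smooth enough to belong to the
  Sobolev space of order \<open>\<alpha>\<close>. The lower bound on the Fourier transform of \<open>\<Phi>\<close> places \<open>g\<close> in the
  reproducing kernel Hilbert space of \<open>\<Phi>\<close>, which means that
  \<open>(\<Sum>i. b i * g (z i))\<^sup>2 \<le> C * (\<Sum>i j. b i * b j * \<Phi> (z i - z j))\<close>
  with a constant independent of the points and coefficients (\<open>bump_evaluation_bound\<close>). A length
  scale \<open>l\<close> merely replaces the points \<open>z i\<close> by \<open>z i / l\<close>, so the same \<open>C\<close> serves every \<open>l\<close>. The
  conditional variance at an omitted site is such a quadratic form, with coefficient \<open>1\<close> there and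
  minus the prediction weights at the other sites (\<open>conditional_variance_quadratic_form\<close>).

  If \<open>g = 1\<close> near \<open>0\<close> and \<open>l\<close> is large, all rescaled sites see the value \<open>1\<close>. For \<open>m\<close>-constant data the
  residual is a constant multiple of the left-hand side, so the standardised residuals stay
  bounded as \<open>l \<rightarrow> \<infinity>\<close> (\<open>loo_standardized_residual_bound\<close>). The conditional variances tend to \<open>0\<close>, because a
  single neighbouring site already predicts with error \<open>2 * (\<Phi> 0 - \<Phi> (h / l))\<close>. Their
  logarithms drive the objective to \<open>-\<infinity>\<close>.

  If instead \<open>g\<close> is a narrow bump centred at the omitted site, the left-hand side is \<open>1\<close> as long as the
  rescaled sites remain separated, that is, for \<open>l\<close> bounded above. The conditional variances are
  then bounded below on every \<open>(0, M]\<close> (\<open>loo_sd_sq_lower_bound\<close>), and so is the objective. Hence a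
  minimising sequence must leave every bounded set.

  The estimate itself is Cauchy--Schwarz on the Fourier side. Inversion is needed for \<open>\<Phi>\<close> and for \<open>g\<close>, and
  is obtained in a Gaussian-regularised form (\<open>regularized_inversion_tendsto\<close>), which requires just a
  bounded continuous integrable function. The bumps are products of one-dimensional plateaus, made
  smooth by repeated averaging over short intervals (\<open>plateau_decay\<close>).
\<close>

section \<open>Gaussians and their Fourier transforms\<close>

text \<open>
  Fubini for functions of product form. It reduces the \<open>d\<close>-dimensional Fourier transforms of
  Gaussians and of tensor-product bumps to one-dimensional ones.
\<close>

lemma lborel_integrable_prod:
  fixes f :: "'a::euclidean_space \<Rightarrow> real \<Rightarrow> 'c::{real_normed_field,banach,second_countable_topology}"
  assumes f: "\<And>b. b \<in> Basis \<Longrightarrow> integrable lborel (f b)"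
  shows "integrable lborel (\<lambda>x. \<Prod>b\<in>Basis. f b (inner x b))" (is ?I)
    and "(LINT x|lborel. (\<Prod>b\<in>Basis. f b (inner x b))) = (\<Prod>b\<in>Basis. LINT t|lborel. f b t)" (is ?E)
proof -
  interpret product_sigma_finite "\<lambda>_::'a. lborel :: real measure" by standard
  have [measurable]: "f b \<in> borel_measurable borel" if "b \<in> Basis" for b
    using borel_measurable_integrable[OF f[OF that]] by simp
  \<comment> \<open>The coordinate map from the product space onto \<open>'a\<close> turns \<open>inner x b\<close> into the coordinate \<open>u b\<close>.\<close>
  have coord: "(\<Prod>b\<in>Basis. f b (inner (\<Sum>b\<in>Basis. u b *\<^sub>R b) b)) = (\<Prod>b\<in>Basis. f b (u b))"
    for u :: "'a \<Rightarrow> real"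
    by (intro prod.cong refl) (simp add: inner_sum_left_Basis)
  have eq: "lborel = distr (\<Pi>\<^sub>M b\<in>(Basis::'a set). lborel) borel (\<lambda>u. \<Sum>b\<in>Basis. u b *\<^sub>R b)"
    by (rule lborel_eq)
  show ?I
    by (subst eq, subst integrable_distr_eq) (auto simp: coord intro!: product_integrable_prod f)
  show ?E
    by (subst eq, subst integral_distr) (auto simp: coord intro!: product_integral_prod f)
qed

text \<open>
  The characteristic function of the standard normal distribution, after undoing the
  normalisation and rescaling.
\<close>

lemma gaussian_fourier_1d:
  fixes s v :: real
  assumes s: "s > 0"
  shows "integrable lborel (\<lambda>t. complex_of_real (exp (- (s * t)\<^sup>2 / 2)) * iexp (v * t))"
    and "(LINT t|lborel. complex_of_real (exp (- (s * t)\<^sup>2 / 2)) * iexp (v * t))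
       = complex_of_real (sqrt (2 * pi) / s * exp (- (v / s)\<^sup>2 / 2))"
proof -
  let ?h = "\<lambda>x. complex_of_real (exp (- x\<^sup>2 / 2)) * iexp (v / s * x)"
  have int0: "integrable lborel (\<lambda>x::real. exp (- x\<^sup>2 / 2))"
    using integrable_mult_right[OF integrable_normal_density[of 1 0], of "sqrt (2 * pi)"]
    by (simp add: normal_density_def)
  have int: "integrable lborel ?h"
    by (rule Bochner_Integration.integrable_bound[OF int0]) (auto simp: norm_mult)
  have "char std_normal_distribution (v / s)
      = (LINT x|lborel. normal_density 0 1 x *\<^sub>R iexp (v / s * x))"
    unfolding char_def by (subst integral_density) (auto simp: normal_density_nonneg)
  also have "\<dots> = (LINT x|lborel. complex_of_real (1 / sqrt (2 * pi)) * ?h x)"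
    by (intro Bochner_Integration.integral_cong refl)
       (simp add: normal_density_def scaleR_conv_of_real mult_ac)
  also have "\<dots> = complex_of_real (1 / sqrt (2 * pi)) * (LINT x|lborel. ?h x)"
    by simp
  finally have h: "(LINT x|lborel. ?h x) = complex_of_real (sqrt (2 * pi) * exp (- (v / s)\<^sup>2 / 2))"
    by (simp add: char_std_normal_distribution field_simps)
  have sc: "?h (0 + s * t) = complex_of_real (exp (- (s * t)\<^sup>2 / 2)) * iexp (v * t)" for t
    using s by simp
  show "integrable lborel (\<lambda>t. complex_of_real (exp (- (s * t)\<^sup>2 / 2)) * iexp (v * t))"
    using lborel_integrable_real_affine[OF int, of s 0] s unfolding sc by simp
  have "(LINT x|lborel. ?h x) = s *\<^sub>R (LINT t|lborel. complex_of_real (exp (- (s * t)\<^sup>2 / 2)) * iexp (v * t))"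
    using lborel_integral_real_affine[of s ?h 0] s unfolding sc by simp
  then show "(LINT t|lborel. complex_of_real (exp (- (s * t)\<^sup>2 / 2)) * iexp (v * t))
       = complex_of_real (sqrt (2 * pi) / s * exp (- (v / s)\<^sup>2 / 2))"
    unfolding h using s by (simp add: scaleR_conv_of_real field_simps)
qed

definition gaussian :: "'a::euclidean_space \<Rightarrow> real" where
  "gaussian u = exp (- (norm u)\<^sup>2 / 2)"

lemma gaussian_bounds: "0 < gaussian u" "0 \<le> gaussian u" "gaussian u \<le> 1"
  by (auto simp: gaussian_def)

lemma gaussian_measurable [measurable]: "gaussian \<in> borel_measurable borel"
  unfolding gaussian_def by measurable

lemma gaussian_prod: "gaussian u = (\<Prod>b\<in>Basis. exp (- (inner u b)\<^sup>2 / 2))"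
proof -
  have "(norm u)\<^sup>2 = (\<Sum>b\<in>Basis. (inner u b)\<^sup>2)"
    unfolding power2_norm_eq_inner by (subst euclidean_inner) (simp add: power2_eq_square)
  then show ?thesis
    by (simp add: gaussian_def exp_sum[symmetric] sum_negf sum_divide_distrib)
qed

lemma gaussian_fourier:
  fixes v :: "'a::euclidean_space"
  assumes s: "s > 0"
  shows "integrable lborel (\<lambda>\<xi>. complex_of_real (gaussian (s *\<^sub>R \<xi>)) * iexp (inner v \<xi>))"
    and "(LINT \<xi>|lborel. complex_of_real (gaussian (s *\<^sub>R \<xi>)) * iexp (inner v \<xi>))
       = complex_of_real ((sqrt (2 * pi) / s) ^ DIM('a) * gaussian (v /\<^sub>R s))"
proof -
  have prd: "complex_of_real (gaussian (s *\<^sub>R \<xi>)) * iexp (inner v \<xi>)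
     = (\<Prod>b\<in>Basis. complex_of_real (exp (- (s * inner \<xi> b)\<^sup>2 / 2)) * iexp (inner v b * inner \<xi> b))"
    for \<xi> :: 'a
  proof -
    have "complex_of_real (gaussian (s *\<^sub>R \<xi>)) = (\<Prod>b\<in>Basis. complex_of_real (exp (- (s * inner \<xi> b)\<^sup>2 / 2)))"
      by (simp add: gaussian_prod)
    moreover have "iexp (inner v \<xi>) = (\<Prod>b\<in>Basis. iexp (inner v b * inner \<xi> b))"
      by (subst euclidean_inner) (simp add: exp_sum[symmetric] sum_distrib_left)
    ultimately show ?thesis by (simp add: prod.distrib)
  qed
  show "integrable lborel (\<lambda>\<xi>. complex_of_real (gaussian (s *\<^sub>R \<xi>)) * iexp (inner v \<xi>))"
    unfolding prd by (rule lborel_integrable_prod(1)) (rule gaussian_fourier_1d(1)[OF s])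
  have "(LINT \<xi>|lborel. complex_of_real (gaussian (s *\<^sub>R \<xi>)) * iexp (inner v \<xi>))
     = (\<Prod>b\<in>Basis. complex_of_real (sqrt (2 * pi) / s * exp (- (inner v b / s)\<^sup>2 / 2)))"
    unfolding prd
    by (subst lborel_integrable_prod(2)[OF gaussian_fourier_1d(1)[OF s]])
       (simp_all only: gaussian_fourier_1d(2)[OF s])
  also have "\<dots> = complex_of_real ((sqrt (2 * pi) / s) ^ DIM('a) * (\<Prod>b\<in>Basis. exp (- (inner v b / s)\<^sup>2 / 2)))"
    by (simp only: of_real_prod[symmetric] prod.distrib prod_constant)
  also have "(\<Prod>b\<in>Basis. exp (- (inner v b / s)\<^sup>2 / 2)) = gaussian (v /\<^sub>R s)"
    unfolding gaussian_prod by (intro prod.cong refl) (simp add: field_simps)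
  finally show "(LINT \<xi>|lborel. complex_of_real (gaussian (s *\<^sub>R \<xi>)) * iexp (inner v \<xi>))
       = complex_of_real ((sqrt (2 * pi) / s) ^ DIM('a) * gaussian (v /\<^sub>R s))" .
qed

lemma gaussian_integrable:
  assumes s: "s > 0"
  shows "integrable lborel (\<lambda>\<xi>::'a::euclidean_space. gaussian (s *\<^sub>R \<xi>))"
  using gaussian_fourier(1)[OF s, of "0::'a"] by (simp add: complex_of_real_integrable_eq)

lemma gaussian_integral:
  "(LINT u|lborel. gaussian (u::'a::euclidean_space)) = sqrt (2 * pi) ^ DIM('a)"
proof -
  have "complex_of_real (LINT u|lborel. gaussian (u::'a)) = complex_of_real (sqrt (2 * pi) ^ DIM('a))"
    using gaussian_fourier(2)[of 1 "0::'a"] by (simp add: gaussian_def)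
  then show ?thesis by (simp only: of_real_eq_iff)
qed

lemma lborel_integral_affine:
  fixes f :: "'a::euclidean_space \<Rightarrow> 'b::{banach, second_countable_topology}"
  assumes c: "c \<noteq> 0" and f [measurable]: "f \<in> borel_measurable borel"
  shows "(LINT x|lborel. f x) = \<bar>c\<bar> ^ DIM('a) *\<^sub>R (LINT x|lborel. f (t + c *\<^sub>R x))"
proof -
  have "(LINT x|lborel. f x)
      = (LINT x|density (distr lborel borel (\<lambda>x. t + c *\<^sub>R x)) (\<lambda>_. \<bar>c\<bar> ^ DIM('a)). f x)"
    by (rule arg_cong[where f = "\<lambda>M. LINT x|M. f x", OF lborel_affine[OF c]])
  also have "\<dots> = (LINT x|distr lborel borel (\<lambda>x. t + c *\<^sub>R x). (\<bar>c\<bar> ^ DIM('a)) *\<^sub>R f x)"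
    by (subst integral_density) auto
  also have "\<dots> = \<bar>c\<bar> ^ DIM('a) *\<^sub>R (LINT x|lborel. f (t + c *\<^sub>R x))"
    by (subst integral_distr) auto
  finally show ?thesis .
qed

section \<open>Gaussian-regularised Fourier inversion\<close>

lemma fourier_transform_measurable:
  assumes [measurable]: "f \<in> borel_measurable borel"
  shows "fourier_transform f \<in> borel_measurable borel"
  unfolding fourier_transform_def by measurable

lemma norm_fourier_transform_le: "norm (fourier_transform f \<xi>) \<le> (LINT x|lborel. \<bar>f x\<bar>)"
  unfolding fourier_transform_def
  by (rule order_trans[OF integral_norm_bound]) (simp add: norm_mult)

text \<open>
  Inserting the factor \<open>gaussian (s *\<^sub>R \<xi>)\<close> makes the inversion integral absolutely convergent,
  because the transform is bounded.
\<close>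

lemma regularized_inversion_integrable:
  fixes f :: "real ^ 'd \<Rightarrow> real"
  assumes s: "s > 0" and f [measurable]: "f \<in> borel_measurable borel"
  shows "integrable lborel (\<lambda>\<xi>. complex_of_real (gaussian (s *\<^sub>R \<xi>)) * fourier_transform f \<xi> * iexp (inner z \<xi>))"
proof (rule Bochner_Integration.integrable_bound)
  note fourier_transform_measurable[OF f, measurable]
  show "integrable lborel (\<lambda>\<xi>::real^'d. gaussian (s *\<^sub>R \<xi>) * (LINT x|lborel. \<bar>f x\<bar>))"
    by (intro integrable_mult_left) (rule gaussian_integrable[OF s])
  show "(\<lambda>\<xi>. complex_of_real (gaussian (s *\<^sub>R \<xi>)) * fourier_transform f \<xi> * iexp (inner z \<xi>))
      \<in> borel_measurable lborel"
    by measurable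
  show "AE \<xi> in lborel. norm (complex_of_real (gaussian (s *\<^sub>R \<xi>)) * fourier_transform f \<xi> * iexp (inner z \<xi>))
      \<le> norm (gaussian (s *\<^sub>R \<xi>) * (LINT x|lborel. \<bar>f x\<bar>))"
    by (intro AE_I2) (auto simp: norm_mult abs_mult intro!: mult_left_mono norm_fourier_transform_le)
qed

text \<open>
  Exchanging the order of integration moves the Fourier integral onto the Gaussian, whose transform
  is explicit; what remains is the average of \<open>f\<close> around \<open>z\<close> with Gaussian weights of width \<open>s\<close>.
\<close>

lemma regularized_inversion_eq:
  fixes f :: "real ^ 'd \<Rightarrow> real"
  assumes s: "s > 0" and f: "integrable lborel f"
  shows "(LINT \<xi>|lborel. complex_of_real (gaussian (s *\<^sub>R \<xi>)) * fourier_transform f \<xi> * iexp (inner z \<xi>))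
    = complex_of_real (sqrt (2 * pi) ^ CARD('d) * (LINT u|lborel. f (z - s *\<^sub>R u) * gaussian u))"
proof -
  have [measurable]: "f \<in> borel_measurable borel" using f by auto
  define F where "F = (\<lambda>(\<xi>::real^'d) t. complex_of_real (gaussian (s *\<^sub>R \<xi>)) * complex_of_real (f t) * iexp (inner (z - t) \<xi>))"
  have F_norm: "norm (F \<xi> t) = gaussian (s *\<^sub>R \<xi>) * \<bar>f t\<bar>" for \<xi> t
    by (simp add: F_def norm_mult abs_of_pos gaussian_bounds)
  have F_meas [measurable]: "case_prod F \<in> borel_measurable (lborel \<Otimes>\<^sub>M lborel)"
    unfolding F_def by measurable
  have F_int: "integrable (lborel \<Otimes>\<^sub>M lborel) (case_prod F)"
  proof (rule lborel_pair.Fubini_integrable)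
    show "integrable lborel (\<lambda>\<xi>. LINT t|lborel. norm (case_prod F (\<xi>, t)))"
      by (simp add: F_norm gaussian_integrable[OF s])
    show "AE \<xi> in lborel. integrable lborel (\<lambda>t. case_prod F (\<xi>, t))"
    proof (intro AE_I2)
      fix \<xi> :: "real^'d"
      have "integrable lborel (\<lambda>t. gaussian (s *\<^sub>R \<xi>) * \<bar>f t\<bar>)" using f by simp
      then show "integrable lborel (\<lambda>t. case_prod F (\<xi>, t))"
      proof (rule Bochner_Integration.integrable_bound)
        show "(\<lambda>t. case_prod F (\<xi>, t)) \<in> borel_measurable lborel"
          unfolding F_def prod.case by measurable
      qed (simp add: F_norm)
    qed
  qed (rule F_meas)
  have "complex_of_real (gaussian (s *\<^sub>R \<xi>)) * fourier_transform f \<xi> * iexp (inner z \<xi>) = (LINT t|lborel. F \<xi> t)" for \<xi>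
  proof -
    have "F \<xi> t = complex_of_real (gaussian (s *\<^sub>R \<xi>)) * iexp (inner z \<xi>) *
            (complex_of_real (f t) * exp (- (\<i> * complex_of_real (inner \<xi> t))))" for t
    proof -
      have "iexp (inner (z - t) \<xi>) = iexp (inner z \<xi>) * exp (- (\<i> * complex_of_real (inner \<xi> t)))"
        by (simp add: inner_diff_left inner_commute[of t] algebra_simps flip: exp_add)
      then show ?thesis by (simp add: F_def)
    qed
    then have "(LINT t|lborel. F \<xi> t) = complex_of_real (gaussian (s *\<^sub>R \<xi>)) * iexp (inner z \<xi>) * fourier_transform f \<xi>"
      unfolding fourier_transform_def by (simp only: integral_mult_right_zero)
    then show ?thesis by (simp only: mult_ac)
  qed
  then have "(LINT \<xi>|lborel. complex_of_real (gaussian (s *\<^sub>R \<xi>)) * fourier_transform f \<xi> * iexp (inner z \<xi>))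
      = (LINT \<xi>|lborel. LINT t|lborel. F \<xi> t)"
    by simp
  also have "\<dots> = (LINT t|lborel. LINT \<xi>|lborel. F \<xi> t)"
    by (rule lborel_pair.Fubini_integral[OF F_int, symmetric])
  also have "\<dots> = (LINT t|lborel. complex_of_real (f t * ((sqrt (2 * pi) / s) ^ CARD('d) * gaussian ((z - t) /\<^sub>R s))))"
  proof (rule Bochner_Integration.integral_cong[OF refl])
    fix t
    have "(LINT \<xi>|lborel. F \<xi> t)
        = (LINT \<xi>|lborel. complex_of_real (f t) * (complex_of_real (gaussian (s *\<^sub>R \<xi>)) * iexp (inner (z - t) \<xi>)))"
      by (simp add: F_def mult_ac)
    also have "\<dots> = complex_of_real (f t) * complex_of_real ((sqrt (2 * pi) / s) ^ CARD('d) * gaussian ((z - t) /\<^sub>R s))"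
      using gaussian_fourier(2)[OF s, of "z - t"] by simp
    finally show "(LINT \<xi>|lborel. F \<xi> t)
        = complex_of_real (f t * ((sqrt (2 * pi) / s) ^ CARD('d) * gaussian ((z - t) /\<^sub>R s)))" by simp
  qed
  also have "\<dots> = complex_of_real (LINT t|lborel. f t * ((sqrt (2 * pi) / s) ^ CARD('d) * gaussian ((z - t) /\<^sub>R s)))"
    by (rule integral_complex_of_real)
  \<comment> \<open>Substitute \<open>t = z - s *\<^sub>R u\<close>.\<close>
  also have "(LINT t|lborel. f t * ((sqrt (2 * pi) / s) ^ CARD('d) * gaussian ((z - t) /\<^sub>R s)))
      = s ^ CARD('d) * (LINT u|lborel. f (z - s *\<^sub>R u) * ((sqrt (2 * pi) / s) ^ CARD('d) * gaussian u))"
    by (subst lborel_integral_affine[where c = "- s" and t = z]) (use s in auto)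
  also have "\<dots> = (LINT u|lborel. s ^ CARD('d) * (f (z - s *\<^sub>R u) * ((sqrt (2 * pi) / s) ^ CARD('d) * gaussian u)))"
    by simp
  also have "\<dots> = (LINT u|lborel. sqrt (2 * pi) ^ CARD('d) * (f (z - s *\<^sub>R u) * gaussian u))"
    using s by (intro Bochner_Integration.integral_cong refl) (simp add: power_divide)
  also have "\<dots> = sqrt (2 * pi) ^ CARD('d) * (LINT u|lborel. f (z - s *\<^sub>R u) * gaussian u)"
    by simp
  finally show ?thesis .
qed

text \<open>
  As the width \<open>s j\<close> shrinks, the Gaussian averages of a bounded continuous function converge to its
  value at \<open>z\<close>. This plays the role of the Fourier inversion theorem.
\<close>

lemma regularized_inversion_tendsto:
  fixes f :: "real ^ 'd \<Rightarrow> real"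
  assumes f: "integrable lborel f" and cont: "continuous_on UNIV f" and bdd: "\<And>x. \<bar>f x\<bar> \<le> B"
    and s: "\<And>j. s j > 0" "s \<longlonglongrightarrow> 0"
  shows "(\<lambda>j. LINT \<xi>|lborel. complex_of_real (gaussian (s j *\<^sub>R \<xi>)) * fourier_transform f \<xi> * iexp (inner z \<xi>))
    \<longlonglongrightarrow> complex_of_real ((2 * pi) ^ CARD('d) * f z)"
proof -
  have [measurable]: "f \<in> borel_measurable borel" using f by auto
  have "(\<lambda>j. LINT u|lborel. f (z - s j *\<^sub>R u) * gaussian u) \<longlonglongrightarrow> (LINT u|lborel. f z * gaussian (u :: real^'d))"
  proof (rule integral_dominated_convergence[where w = "\<lambda>u. B * gaussian u"])
    show "integrable lborel (\<lambda>u::real^'d. B * gaussian u)"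
      using gaussian_integrable[where s = 1 and 'a = "real^'d"] by simp
    show "AE u in lborel. (\<lambda>j. f (z - s j *\<^sub>R u) * gaussian u) \<longlonglongrightarrow> f z * gaussian u"
    proof (intro AE_I2 tendsto_intros)
      fix u
      have "(\<lambda>j. z - s j *\<^sub>R u) \<longlonglongrightarrow> z - 0 *\<^sub>R u" by (intro tendsto_intros s)
      then have "(\<lambda>j. z - s j *\<^sub>R u) \<longlonglongrightarrow> z" by simp
      moreover have "isCont f z" using cont by (simp add: continuous_on_eq_continuous_at)
      ultimately show "(\<lambda>j. f (z - s j *\<^sub>R u)) \<longlonglongrightarrow> f z" by (rule isCont_tendsto_compose[rotated])
    qed
    show "AE u in lborel. norm (f (z - s j *\<^sub>R u) * gaussian u) \<le> B * gaussian u" for j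
      by (intro AE_I2) (simp add: abs_mult abs_of_pos gaussian_bounds mult_right_mono bdd)
  qed measurable
  then have "(\<lambda>j. complex_of_real (sqrt (2 * pi) ^ CARD('d) * (LINT u|lborel. f (z - s j *\<^sub>R u) * gaussian u)))
    \<longlonglongrightarrow> complex_of_real (sqrt (2 * pi) ^ CARD('d) * (LINT u|lborel. f z * gaussian (u :: real^'d)))"
    by (intro tendsto_intros)
  moreover have "sqrt (2 * pi) ^ CARD('d) * (LINT u|lborel. f z * gaussian (u::real^'d)) = (2 * pi) ^ CARD('d) * f z"
  proof -
    have "(2 * pi) ^ CARD('d) = sqrt (2 * pi) ^ CARD('d) * sqrt (2 * pi) ^ CARD('d)"
      by (simp only: power_mult_distrib[symmetric] real_sqrt_mult_self) simp
    then show ?thesis by (simp add: gaussian_integral)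
  qed
  ultimately show ?thesis
    by (simp only: regularized_inversion_eq[OF s(1) f])
qed

section \<open>Evaluation functionals and the kernel quadratic form\<close>

text \<open>
  The Cauchy--Schwarz inequality recovered from its arithmetic-geometric form with a free weight
  \<open>t\<close>. The additive form is what passes through integrals and limits.
\<close>

lemma sq_le_from_weighted_mean_bound:
  fixes L Q V :: real
  assumes bound: "\<And>t. t > 0 \<Longrightarrow> L \<le> t / 2 * Q + V / (2 * t)" and L: "L \<ge> 0" and V: "V > 0"
  shows "L\<^sup>2 \<le> V * Q"
proof -
  have Q: "Q \<ge> 0"
  proof (rule ccontr)
    assume "\<not> Q \<ge> 0"
    then have neg: "Q < 0" by simp
    \<comment> \<open>For a negative \<open>Q\<close> this weight makes the right-hand side negative.\<close>
    define t where "t = sqrt (2 * V / (- Q))"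
    have t: "t > 0" using neg V by (simp add: t_def divide_pos_neg)
    have "t * t = 2 * V / (- Q)" using neg V by (simp add: t_def divide_nonneg_neg)
    then have "t * t * Q = - 2 * V" using neg by (simp add: field_simps)
    then have "t / 2 * Q + V / (2 * t) = - V / (2 * t)" using t by (simp add: field_simps)
    then show False using bound[OF t] L V t by (smt (verit) divide_neg_pos)
  qed
  show ?thesis
  proof (cases "L = 0")
    case True
    then show ?thesis using Q V by simp
  next
    case False
    then have L: "L > 0" using L by simp
    have "Q \<noteq> 0"
    proof
      assume "Q = 0"
      then show False using bound[of "V / L"] L V by (simp add: field_simps)
    qed
    then have Q: "Q > 0" using Q by simp
    \<comment> \<open>The weight that minimises the right-hand side when \<open>L\<^sup>2 = V * Q\<close>.\<close>
    have "L \<le> L / Q / 2 * Q + V / (2 * (L / Q))" using bound[of "L / Q"] L Q by simp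
    then have "L \<le> L / 2 + V * Q / (2 * L)" using L Q by simp
    then show ?thesis using L by (simp add: field_simps power2_eq_square)
  qed
qed

definition trig_sum :: "'i set \<Rightarrow> ('i \<Rightarrow> real) \<Rightarrow> ('i \<Rightarrow> 'a::real_inner) \<Rightarrow> 'a \<Rightarrow> complex" where
  "trig_sum I b z \<xi> = (\<Sum>i\<in>I. complex_of_real (b i) * iexp (inner (z i) \<xi>))"

text \<open>
  The squared modulus of a trigonometric sum is again a trigonometric sum, over the differences of
  the frequencies; this is how a translation-invariant quadratic form becomes an integral.
\<close>

lemma trig_sum_cmod_sq:
  "complex_of_real ((cmod (trig_sum I b z \<xi>))\<^sup>2)
     = (\<Sum>i\<in>I. \<Sum>j\<in>I. complex_of_real (b i * b j) * iexp (inner (z i - z j) \<xi>))"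
proof -
  have "complex_of_real ((cmod (trig_sum I b z \<xi>))\<^sup>2) = trig_sum I b z \<xi> * cnj (trig_sum I b z \<xi>)"
    by (rule complex_norm_square)
  also have "cnj (trig_sum I b z \<xi>) = (\<Sum>j\<in>I. complex_of_real (b j) * exp (- (\<i> * complex_of_real (inner (z j) \<xi>))))"
    by (simp add: trig_sum_def exp_cnj)
  also have "trig_sum I b z \<xi> * \<dots> = (\<Sum>i\<in>I. \<Sum>j\<in>I. complex_of_real (b i * b j) * iexp (inner (z i - z j) \<xi>))"
    unfolding trig_sum_def sum_product
  proof (intro sum.cong refl)
    fix i j
    have "iexp (inner (z i - z j) \<xi>) = iexp (inner (z i) \<xi>) * exp (- (\<i> * complex_of_real (inner (z j) \<xi>)))"
      by (simp add: inner_diff_left algebra_simps flip: exp_add)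
    then show "complex_of_real (b i) * iexp (inner (z i) \<xi>) * (complex_of_real (b j) * exp (- (\<i> * complex_of_real (inner (z j) \<xi>))))
        = complex_of_real (b i * b j) * iexp (inner (z i - z j) \<xi>)"
      by (simp add: mult_ac)
  qed
  finally show ?thesis .
qed

lemma regularized_inversion_sum:
  fixes f :: "real ^ 'd \<Rightarrow> real" and a :: "'k \<Rightarrow> real" and v :: "'k \<Rightarrow> real ^ 'd" and K :: "'k set"
  assumes f: "integrable lborel f" and cont: "continuous_on UNIV f" and bdd: "\<And>x. \<bar>f x\<bar> \<le> B"
    and s: "\<And>j. s j > 0" "s \<longlonglongrightarrow> 0"
  defines "G \<equiv> \<lambda>j \<xi>. complex_of_real (gaussian (s j *\<^sub>R \<xi>)) * fourier_transform f \<xi> * (\<Sum>k\<in>K. complex_of_real (a k) * iexp (inner (v k) \<xi>))"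
  shows "integrable lborel (G j)"
    and "(\<lambda>j. LINT \<xi>|lborel. G j \<xi>) \<longlonglongrightarrow> complex_of_real ((2 * pi) ^ CARD('d) * (\<Sum>k\<in>K. a k * f (v k)))"
proof -
  let ?T = "\<lambda>j k \<xi>. complex_of_real (gaussian (s j *\<^sub>R \<xi>)) * fourier_transform f \<xi> * iexp (inner (v k) \<xi>)"
  have fm: "f \<in> borel_measurable borel" using f by auto
  have G: "G j = (\<lambda>\<xi>. \<Sum>k\<in>K. complex_of_real (a k) * ?T j k \<xi>)" for j
    by (simp add: G_def sum_distrib_left mult_ac)
  have int: "integrable lborel (\<lambda>\<xi>. complex_of_real (a k) * ?T j k \<xi>)" for j k
    by (intro integrable_mult_right regularized_inversion_integrable s fm)
  show "integrable lborel (G j)"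
    unfolding G by (intro Bochner_Integration.integrable_sum int)
  have "(LINT \<xi>|lborel. G j \<xi>) = (\<Sum>k\<in>K. complex_of_real (a k) * (LINT \<xi>|lborel. ?T j k \<xi>))" for j
    unfolding G by (subst Bochner_Integration.integral_sum[OF int]) (simp only: integral_mult_right_zero)
  moreover have "(\<lambda>j. \<Sum>k\<in>K. complex_of_real (a k) * (LINT \<xi>|lborel. ?T j k \<xi>))
      \<longlonglongrightarrow> (\<Sum>k\<in>K. complex_of_real (a k) * complex_of_real ((2 * pi) ^ CARD('d) * f (v k)))"
    by (intro tendsto_sum tendsto_mult_left regularized_inversion_tendsto[OF f cont bdd s])
  ultimately show "(\<lambda>j. LINT \<xi>|lborel. G j \<xi>) \<longlonglongrightarrow> complex_of_real ((2 * pi) ^ CARD('d) * (\<Sum>k\<in>K. a k * f (v k)))"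
    by (simp add: sum_distrib_left mult_ac)
qed

text \<open>
  The hypothesis \<open>g_decay\<close> says that \<open>g\<close> lies in the reproducing kernel Hilbert space of \<open>\<Phi>\<close>, with
  norm controlled by the integral of \<open>H\<close>, and the conclusion is the continuity of the functional
  \<open>\<Sum>i. b i * f (z i)\<close> at \<open>f = g\<close>. The left-hand side is the integral of the transform of \<open>g\<close> against
  a trigonometric sum \<open>E\<close>, the right-hand side the integral of the transform of \<open>\<Phi>\<close> against
  \<open>\<bar>E\<bar>\<^sup>2\<close>, and the two are compared by Cauchy--Schwarz. Both integrals carry the Gaussian regulariser, which is
  removed at the end. The constant does not depend on the coefficients, the sites or their number.
\<close>

lemma evaluation_bound:
  fixes \<Phi> g H :: "real ^ 'd \<Rightarrow> real"
  assumes \<Phi>: "integrable lborel \<Phi>" "continuous_on UNIV \<Phi>" "\<And>x. \<bar>\<Phi> x\<bar> \<le> B\<^sub>1"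
    and \<Phi>_real: "\<And>\<xi>. fourier_transform \<Phi> \<xi> \<in> \<real>"
    and \<Phi>_pos: "\<And>\<xi>. Re (fourier_transform \<Phi> \<xi>) > 0"
    and g: "integrable lborel g" "continuous_on UNIV g" "\<And>x. \<bar>g x\<bar> \<le> B\<^sub>2"
    and H: "integrable lborel H"
    and g_decay: "\<And>\<xi>. (cmod (fourier_transform g \<xi>))\<^sup>2 \<le> H \<xi> * Re (fourier_transform \<Phi> \<xi>)"
  obtains C where "C > 0"
    and "\<And>(I :: 'i set) b z. (\<Sum>i\<in>I. b i * g (z i))\<^sup>2 \<le> C * (\<Sum>i\<in>I. \<Sum>j\<in>I. b i * b j * \<Phi> (z i - z j))"
proof -
  define N where "N = (2 * pi) ^ CARD('d)"
  \<comment> \<open>Adding \<open>1\<close> keeps \<open>V\<close> strictly positive even if \<open>H\<close> vanishes almost everywhere.\<close>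
  define V where "V = ((LINT \<xi>|lborel. H \<xi>) + 1) / N"
  have H_nonneg: "H \<xi> \<ge> 0" for \<xi>
  proof -
    have "0 \<le> H \<xi> * Re (fourier_transform \<Phi> \<xi>)"
      by (rule order_trans[OF _ g_decay]) simp
    then show ?thesis using \<Phi>_pos[of \<xi>] by (simp add: zero_le_mult_iff)
  qed
  have N: "N > 0" by (simp add: N_def)
  have V: "V > 0" using N H_nonneg by (simp add: V_def add_nonneg_pos)
  define s where "s = (\<lambda>j. 1 / real (Suc j))"
  have s: "s j > 0" "s \<longlonglongrightarrow> 0" for j
    unfolding s_def using LIMSEQ_inverse_real_of_nat by (simp_all add: inverse_eq_divide)
  have "(\<Sum>i\<in>I. b i * g (z i))\<^sup>2 \<le> V * (\<Sum>i\<in>I. \<Sum>j\<in>I. b i * b j * \<Phi> (z i - z j))"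
    for I :: "'i set" and b z
  proof -
    define L where "L = (\<Sum>i\<in>I. b i * g (z i))"
    define Q where "Q = (\<Sum>i\<in>I. \<Sum>j\<in>I. b i * b j * \<Phi> (z i - z j))"
    define E where "E = trig_sum I b z"
    define F where "F = (\<lambda>j \<xi>. complex_of_real (gaussian (s j *\<^sub>R \<xi>)) * fourier_transform g \<xi> * E \<xi>)"
    define G where "G = (\<lambda>j \<xi>. complex_of_real (gaussian (s j *\<^sub>R \<xi>)) * fourier_transform \<Phi> \<xi> * complex_of_real ((cmod (E \<xi>))\<^sup>2))"
    have F: "integrable lborel (F j)" "(\<lambda>j. LINT \<xi>|lborel. F j \<xi>) \<longlonglongrightarrow> complex_of_real (N * L)" for j
      unfolding F_def E_def trig_sum_def N_def L_def
      by (rule regularized_inversion_sum[OF g s])+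
    have sum_pair: "(\<Sum>i\<in>I. \<Sum>j\<in>I. h i j) = (\<Sum>p\<in>I\<times>I. h (fst p) (snd p))" for h :: "'i \<Rightarrow> 'i \<Rightarrow> 'c::comm_monoid_add"
      by (simp add: sum.cartesian_product case_prod_beta)
    have G: "integrable lborel (G j)" "(\<lambda>j. LINT \<xi>|lborel. G j \<xi>) \<longlonglongrightarrow> complex_of_real (N * Q)" for j
      unfolding G_def E_def trig_sum_cmod_sq N_def Q_def sum_pair
      by (rule regularized_inversion_sum[OF \<Phi> s])+
    have ReG: "Re (G j \<xi>) = gaussian (s j *\<^sub>R \<xi>) * Re (fourier_transform \<Phi> \<xi>) * (cmod (E \<xi>))\<^sup>2" for j \<xi>
      using \<Phi>_real[of \<xi>] by (auto simp: G_def elim!: Reals_cases)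
    have "\<bar>L\<bar> \<le> t / 2 * Q + V / (2 * t)" if t: "t > 0" for t
    proof -
      have pt: "cmod (F j \<xi>) \<le> t / 2 * Re (G j \<xi>) + H \<xi> / (2 * t)" for j \<xi>
      proof -
        define p where "p = Re (fourier_transform \<Phi> \<xi>)"
        define w where "w = gaussian (s j *\<^sub>R \<xi>)"
        define e where "e = cmod (E \<xi>)"
        define c where "c = cmod (fourier_transform g \<xi>)"
        have p: "p > 0" using \<Phi>_pos by (simp add: p_def)
        have w: "0 \<le> w" "w \<le> 1" by (simp_all add: w_def gaussian_bounds)
        \<comment> \<open>Young's inequality for the product of \<open>c\<close> and \<open>e\<close>, with weight \<open>t * p\<close>.\<close>
        have "0 \<le> (t * p * e - c)\<^sup>2" by simp
        then have "2 * t * p * (c * e) \<le> t\<^sup>2 * p\<^sup>2 * e\<^sup>2 + c\<^sup>2"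
          by (simp add: power2_diff power_mult_distrib algebra_simps)
        also have "\<dots> \<le> t\<^sup>2 * p\<^sup>2 * e\<^sup>2 + H \<xi> * p"
          using g_decay[of \<xi>] by (simp add: c_def p_def)
        also have "\<dots> = 2 * t * p * (t / 2 * (p * e\<^sup>2) + H \<xi> / (2 * t))"
          using t by (simp add: field_simps power2_eq_square)
        finally have "c * e \<le> t / 2 * (p * e\<^sup>2) + H \<xi> / (2 * t)"
          using t p by (simp only: mult_le_cancel_left_pos mult_pos_pos zero_less_numeral)
        then have "w * (c * e) \<le> w * (t / 2 * (p * e\<^sup>2) + H \<xi> / (2 * t))"
          by (rule mult_left_mono) (rule w)
        also have "\<dots> = t / 2 * (w * p * e\<^sup>2) + w * (H \<xi> / (2 * t))"
          by (simp add: algebra_simps)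
        also have "w * (H \<xi> / (2 * t)) \<le> H \<xi> / (2 * t)"
          using w t H_nonneg[of \<xi>] by (intro mult_left_le_one_le) auto
        finally show ?thesis
          by (simp add: ReG F_def norm_mult abs_of_nonneg w p_def[symmetric] w_def[symmetric] e_def[symmetric] c_def[symmetric] mult.assoc)
      qed
      have "cmod (LINT \<xi>|lborel. F j \<xi>) \<le> t / 2 * Re (LINT \<xi>|lborel. G j \<xi>) + (LINT \<xi>|lborel. H \<xi>) / (2 * t)" for j
      proof -
        have "cmod (LINT \<xi>|lborel. F j \<xi>) \<le> (LINT \<xi>|lborel. cmod (F j \<xi>))"
          by (rule integral_norm_bound)
        also have "\<dots> \<le> (LINT \<xi>|lborel. t / 2 * Re (G j \<xi>) + H \<xi> / (2 * t))"
          using F(1)[of j] G(1)[of j] H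
          by (intro integral_mono pt) (auto intro!: Bochner_Integration.integrable_add integrable_mult_right integrable_Re)
        also have "\<dots> = t / 2 * Re (LINT \<xi>|lborel. G j \<xi>) + (LINT \<xi>|lborel. H \<xi>) / (2 * t)"
          using G(1)[of j] H by (subst Bochner_Integration.integral_add) auto
        finally show ?thesis .
      qed
      moreover have "(\<lambda>j. cmod (LINT \<xi>|lborel. F j \<xi>)) \<longlonglongrightarrow> cmod (complex_of_real (N * L))"
        by (intro tendsto_norm F(2))
      moreover have "(\<lambda>j. t / 2 * Re (LINT \<xi>|lborel. G j \<xi>) + (LINT \<xi>|lborel. H \<xi>) / (2 * t))
          \<longlonglongrightarrow> t / 2 * Re (complex_of_real (N * Q)) + (LINT \<xi>|lborel. H \<xi>) / (2 * t)"
        by (intro tendsto_intros G(2))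
      ultimately have "cmod (complex_of_real (N * L)) \<le> t / 2 * Re (complex_of_real (N * Q)) + (LINT \<xi>|lborel. H \<xi>) / (2 * t)"
        by (intro LIMSEQ_le) auto
      then have "N * \<bar>L\<bar> \<le> t / 2 * (N * Q) + (LINT \<xi>|lborel. H \<xi>) / (2 * t)"
        using N by (simp add: norm_mult abs_mult)
      also have "\<dots> \<le> t / 2 * (N * Q) + ((LINT \<xi>|lborel. H \<xi>) + 1) / (2 * t)"
        using t by (simp add: divide_right_mono)
      also have "\<dots> = N * (t / 2 * Q + V / (2 * t))"
        using N t by (simp add: V_def field_simps)
      finally show ?thesis using N by simp
    qed
    then have "\<bar>L\<bar>\<^sup>2 \<le> V * Q" by (rule sq_le_from_weighted_mean_bound) (use V in auto)
    then show ?thesis by (simp add: L_def Q_def)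
  qed
  with V show ?thesis by (rule that)
qed

section \<open>Cut-off functions on the line\<close>

text \<open>
  The transform of an interval decays like \<open>1 / \<bar>t\<bar>\<close>, uniformly in its length.
\<close>

lemma norm_integral_iexp_le:
  assumes h: "h > 0"
  shows "\<bar>t\<bar> * norm (LINT y|lborel. complex_of_real (indicator {-h..h} y) * iexp (t * y)) \<le> 2"
proof (cases "t = 0")
  case False
  define F where "F = (\<lambda>y. iexp (t * y) / (\<i> * complex_of_real t))"
  have "(LINT y|lborel. indicator {-h..h} y *\<^sub>R iexp (t * y)) = F h - F (- h)"
  proof (rule integral_FTC_Icc)
    show "(F has_vector_derivative iexp (t * x)) (at x within {-h..h})" for x
      unfolding F_def using False
      by (auto intro!: derivative_eq_intros has_vector_derivative_real_field simp: field_simps)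
    show "continuous_on {-h..h} (\<lambda>x. iexp (t * x))" by (intro continuous_intros)
  qed (use h in simp)
  then have "(LINT y|lborel. complex_of_real (indicator {-h..h} y) * iexp (t * y)) = F h - F (- h)"
    by (simp add: scaleR_conv_of_real)
  moreover have "norm (F h - F (- h)) \<le> 1 / \<bar>t\<bar> + 1 / \<bar>t\<bar>"
    by (rule order_trans[OF norm_triangle_ineq4]) (simp add: F_def norm_divide norm_mult)
  ultimately show ?thesis using False by (simp only:) (simp add: field_simps)
qed simp

definition plateau :: "real \<Rightarrow> real \<Rightarrow> (real \<Rightarrow> real) \<Rightarrow> bool" where
  "plateau p r \<phi> \<longleftrightarrow> continuous_on UNIV \<phi> \<and> (\<forall>x. \<bar>x\<bar> \<le> p \<longrightarrow> \<phi> x = 1) \<and> (\<forall>x. \<bar>x\<bar> \<ge> r \<longrightarrow> \<phi> x = 0)"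

definition fourier_1d :: "(real \<Rightarrow> real) \<Rightarrow> real \<Rightarrow> complex" where
  "fourier_1d \<phi> t = (LINT x|lborel. complex_of_real (\<phi> x) * iexp (- (t * x)))"

lemma plateau_measurable: "plateau p r \<phi> \<Longrightarrow> \<phi> \<in> borel_measurable borel"
  by (auto simp: plateau_def intro: borel_measurable_continuous_onI)

lemma plateau_bounded:
  assumes "plateau p r \<phi>"
  obtains B where "B > 0" "\<And>x. \<bar>\<phi> x\<bar> \<le> B * indicator {-r..r} x" "\<And>x. \<bar>\<phi> x\<bar> \<le> B"
proof -
  have "compact (\<phi> ` {-r..r})"
    using assms by (intro compact_continuous_image) (auto simp: plateau_def intro: continuous_on_subset)
  then obtain B where B: "B > 0" "\<And>x. x \<in> {-r..r} \<Longrightarrow> \<bar>\<phi> x\<bar> \<le> B"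
    using compact_imp_bounded[of "\<phi> ` {-r..r}"] by (auto simp: bounded_pos)
  have le: "\<bar>\<phi> x\<bar> \<le> B * indicator {-r..r} x" for x
    using B(2)[of x] assms by (cases "x \<in> {-r..r}") (auto simp: plateau_def)
  have "B * indicator {-r..r} x \<le> B" for x using B(1) by (simp add: indicator_def)
  then have "\<bar>\<phi> x\<bar> \<le> B" for x using le order_trans by blast
  then show ?thesis using that[of B] B(1) le by blast
qed

lemma plateau_integrable:
  assumes "plateau p r \<phi>"
  shows "integrable lborel \<phi>"
proof -
  obtain B where B: "B > 0" "\<And>x. \<bar>\<phi> x\<bar> \<le> B * indicator {-r..r} x"
    using plateau_bounded[OF assms] by metis
  note plateau_measurable[OF assms, measurable]
  have "integrable lborel (\<lambda>x::real. B * indicator {-r..r} x)" by (simp add: emeasure_lborel_Icc_eq)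
  then show ?thesis
    by (rule Bochner_Integration.integrable_bound) (use B in \<open>auto simp: abs_mult\<close>)
qed

text \<open>
  Convolution with the uniform density on \<open>[-h, h]\<close>. Each application costs a margin \<open>h\<close> at either end
  of the transition region and gains one power of decay of the transform.
\<close>

definition box_average :: "real \<Rightarrow> (real \<Rightarrow> real) \<Rightarrow> real \<Rightarrow> real" where
  "box_average h \<phi> x = 1 / (2 * h) * (LINT y|lborel. indicator {-h..h} y * \<phi> (x + y))"

lemma plateau_box_average:
  assumes h: "h > 0" and pl: "plateau (p + h) (r - h) \<phi>"
  shows "plateau p r (box_average h \<phi>)"
proof -
  note plateau_measurable[OF pl, measurable]
  obtain B where B: "B > 0" "\<And>x. \<bar>\<phi> x\<bar> \<le> B"
    using plateau_bounded[OF pl] by metis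
  have "continuous_on UNIV (box_average h \<phi>)"
    unfolding continuous_on_sequentially
  proof (intro allI ballI impI, elim conjE)
    fix u :: "nat \<Rightarrow> real" and a assume u: "u \<longlonglongrightarrow> a"
    have "(\<lambda>n. LINT y|lborel. indicator {-h..h} y * \<phi> (u n + y)) \<longlonglongrightarrow> (LINT y|lborel. indicator {-h..h} y * \<phi> (a + y))"
    proof (rule integral_dominated_convergence[where w = "\<lambda>y. B * indicator {-h..h} y"])
      show "integrable lborel (\<lambda>y::real. B * indicator {-h..h} y)" by (simp add: emeasure_lborel_Icc_eq)
      show "AE y in lborel. (\<lambda>n. indicator {-h..h} y * \<phi> (u n + y)) \<longlonglongrightarrow> indicator {-h..h} y * \<phi> (a + y)"
      proof (intro AE_I2 tendsto_mult_left)
        fix y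
        have "isCont \<phi> (a + y)" using pl by (simp add: plateau_def continuous_on_eq_continuous_at)
        moreover have "(\<lambda>n. u n + y) \<longlonglongrightarrow> a + y" by (intro tendsto_intros u)
        ultimately show "(\<lambda>n. \<phi> (u n + y)) \<longlonglongrightarrow> \<phi> (a + y)" by (rule isCont_tendsto_compose)
      qed
      show "AE y in lborel. norm (indicator {-h..h} y * \<phi> (u n + y)) \<le> B * indicator {-h..h} y" for n
        using B by (auto simp: indicator_def)
    qed measurable
    then show "(box_average h \<phi> \<circ> u) \<longlonglongrightarrow> box_average h \<phi> a"
      unfolding box_average_def o_def by (intro tendsto_mult_left)
  qed
  moreover have "box_average h \<phi> x = 1" if "\<bar>x\<bar> \<le> p" for x
  proof -
    have "indicator {-h..h} y * \<phi> (x + y) = indicator {-h..h} y" for y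
      using pl that by (auto simp: plateau_def indicator_def)
    then have "box_average h \<phi> x = 1 / (2 * h) * (LINT y|lborel. indicator {-h..h} y)"
      unfolding box_average_def by (simp only:)
    then show ?thesis using h by simp
  qed
  moreover have "box_average h \<phi> x = 0" if "\<bar>x\<bar> \<ge> r" for x
  proof -
    have "indicator {-h..h} y * \<phi> (x + y) = 0" for y
      using pl that by (auto simp: plateau_def indicator_def)
    then have "box_average h \<phi> x = 1 / (2 * h) * (LINT y::real|lborel. 0)"
      unfolding box_average_def by (simp only:)
    then show ?thesis by simp
  qed
  ultimately show ?thesis by (auto simp: plateau_def)
qed

text \<open>
  The convolution theorem for \<^const>\<open>box_average\<close>: the transform is multiplied by \<open>sin (h * t) / (h * t)\<close>,
  here left as an integral.
\<close>

lemma fourier_1d_box_average: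
  assumes h: "h > 0" and pl: "plateau p r \<phi>"
  shows "fourier_1d (box_average h \<phi>) t
    = fourier_1d \<phi> t * (LINT y|lborel. complex_of_real (indicator {-h..h} y) * iexp (t * y)) / complex_of_real (2 * h)"
proof -
  note plateau_measurable[OF pl, measurable]
  obtain B where B: "B > 0" "\<And>x. \<bar>\<phi> x\<bar> \<le> B * indicator {-r..r} x" "\<And>x. \<bar>\<phi> x\<bar> \<le> B"
    using plateau_bounded[OF pl] by metis
  define F where "F = (\<lambda>x y. complex_of_real (indicator {-h..h} y * \<phi> (x + y)) * iexp (- (t * x)))"
  have F_int: "integrable (lborel \<Otimes>\<^sub>M lborel) (case_prod F)"
  proof (rule Bochner_Integration.integrable_bound)
    show "integrable (lborel \<Otimes>\<^sub>M lborel) (\<lambda>q::real\<times>real. B * indicator ({-(r+h)..r+h} \<times> {-h..h}) q)"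
      by (auto simp: lborel.emeasure_pair_measure_Times emeasure_lborel_Icc_eq ennreal_mult_less_top)
    show "case_prod F \<in> borel_measurable (lborel \<Otimes>\<^sub>M lborel)"
      unfolding F_def by measurable
    show "AE q in lborel \<Otimes>\<^sub>M lborel. norm (case_prod F q) \<le> norm (B * indicator ({-(r+h)..r+h} \<times> {-h..h}) q)"
    proof (intro AE_I2)
      fix q :: "real \<times> real"
      obtain x y where q: "q = (x, y)" by (cases q)
      have "\<bar>\<phi> (x + y)\<bar> \<le> B * indicator {-r..r} (x + y)" by (rule B(2))
      moreover have "\<bar>\<phi> (x + y)\<bar> \<le> B" by (rule B(3))
      ultimately show "norm (case_prod F q) \<le> norm (B * indicator ({-(r+h)..r+h} \<times> {-h..h}) q)"
        using B(1) unfolding q F_def by (auto simp: norm_mult indicator_def split: if_splits)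
    qed
  qed
  have "fourier_1d (box_average h \<phi>) t = (LINT x|lborel. (LINT y|lborel. F x y) / complex_of_real (2 * h))"
    unfolding fourier_1d_def
  proof (intro Bochner_Integration.integral_cong refl)
    fix x
    have "(LINT y|lborel. F x y) = (LINT y|lborel. complex_of_real (indicator {-h..h} y * \<phi> (x + y))) * iexp (- (t * x))"
      by (simp only: F_def integral_mult_left_zero)
    also have "(LINT y|lborel. complex_of_real (indicator {-h..h} y * \<phi> (x + y)))
        = complex_of_real (LINT y|lborel. indicator {-h..h} y * \<phi> (x + y))"
      by (rule integral_complex_of_real)
    finally show "complex_of_real (box_average h \<phi> x) * iexp (- (t * x)) = (LINT y|lborel. F x y) / complex_of_real (2 * h)"
      by (simp add: box_average_def)
  qed
  also have "\<dots> = (LINT x|lborel. LINT y|lborel. F x y) / complex_of_real (2 * h)"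
    by (rule integral_divide_zero)
  also have "(LINT x|lborel. LINT y|lborel. F x y) = (LINT y|lborel. LINT x|lborel. F x y)"
    by (rule lborel_pair.Fubini_integral[OF F_int, symmetric])
  also have "\<dots> = (LINT y|lborel. fourier_1d \<phi> t * (complex_of_real (indicator {-h..h} y) * iexp (t * y)))"
  proof (intro Bochner_Integration.integral_cong refl)
    fix y
    let ?e = "\<lambda>x. complex_of_real (\<phi> x) * iexp (- (t * x))"
    have "F x y = complex_of_real (indicator {-h..h} y) * iexp (t * y) * ?e (y + 1 * x)" for x
    proof -
      have "iexp (- (t * x)) = iexp (t * y) * iexp (- (t * (y + 1 * x)))"
        by (simp add: algebra_simps flip: exp_add)
      then show ?thesis by (simp add: F_def add.commute)
    qed
    then have "(LINT x|lborel. F x y) = complex_of_real (indicator {-h..h} y) * iexp (t * y) * (LINT x|lborel. ?e (y + 1 * x))"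
      by (simp only: integral_mult_right_zero)
    also have "(LINT x|lborel. ?e (y + 1 * x)) = fourier_1d \<phi> t"
      unfolding fourier_1d_def using lborel_integral_real_affine[of 1 ?e y] by simp
    finally show "(LINT x|lborel. F x y) = fourier_1d \<phi> t * (complex_of_real (indicator {-h..h} y) * iexp (t * y))"
      by (simp only: mult_ac)
  qed
  also have "\<dots> = fourier_1d \<phi> t * (LINT y|lborel. complex_of_real (indicator {-h..h} y) * iexp (t * y))"
    by (rule integral_mult_right_zero)
  finally show ?thesis .
qed

lemma norm_fourier_1d_le: "cmod (fourier_1d \<phi> t) \<le> (LINT x|lborel. \<bar>\<phi> x\<bar>)"
  unfolding fourier_1d_def by (rule order_trans[OF integral_norm_bound]) (simp add: norm_mult)

text \<open>
  Start from a trapezoid and average repeatedly, spending a third of the remaining gap between \<open>p\<close>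
  and \<open>r\<close> at each end every time.
\<close>

lemma plateau_decay:
  assumes "p < r"
  shows "\<exists>\<phi> C. plateau p r \<phi> \<and> (\<forall>t. \<bar>t\<bar> ^ k * cmod (fourier_1d \<phi> t) \<le> C)"
  using assms
proof (induction k arbitrary: p r)
  case 0
  define \<phi> where "\<phi> = (\<lambda>x::real. max 0 (min 1 ((r - \<bar>x\<bar>) / (r - p))))"
  have "plateau p r \<phi>"
    unfolding plateau_def \<phi>_def
  proof (intro conjI allI impI)
    show "continuous_on UNIV (\<lambda>x::real. max 0 (min 1 ((r - \<bar>x\<bar>) / (r - p))))"
      using 0 by (intro continuous_intros) auto
  qed (use 0 in \<open>auto simp: divide_nonpos_pos max_def min_def field_simps\<close>)
  then show ?case using norm_fourier_1d_le[of \<phi>] by auto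
next
  case (Suc k)
  define h where "h = (r - p) / 3"
  have h: "h > 0" "p + h < r - h" using Suc.prems by (auto simp: h_def field_simps)
  obtain \<phi> C where \<phi>: "plateau (p + h) (r - h) \<phi>" and C: "\<And>t. \<bar>t\<bar> ^ k * cmod (fourier_1d \<phi> t) \<le> C"
    using Suc.IH[OF h(2)] by auto
  have "\<bar>t\<bar> ^ Suc k * cmod (fourier_1d (box_average h \<phi>) t) \<le> C * 2 / (2 * h)" for t
  proof -
    let ?J = "LINT y|lborel. complex_of_real (indicator {-h..h} y) * iexp (t * y)"
    have "\<bar>t\<bar> ^ Suc k * cmod (fourier_1d (box_average h \<phi>) t)
        = (\<bar>t\<bar> ^ k * cmod (fourier_1d \<phi> t)) * (\<bar>t\<bar> * cmod ?J) / (2 * h)"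
      using h by (simp add: fourier_1d_box_average[OF h(1) \<phi>] norm_mult norm_divide)
    also have "\<dots> \<le> C * 2 / (2 * h)"
      using h C[of t] norm_integral_iexp_le[OF h(1), of t]
      by (intro divide_right_mono mult_mono) (auto intro: order_trans[OF _ C])
    finally show ?thesis .
  qed
  then show ?case using plateau_box_average[OF h(1) \<phi>] by blast
qed

section \<open>Sobolev bumps in several dimensions\<close>

text \<open>
  Polynomial decay of sufficiently high order, together with boundedness for small \<open>t\<close>, beats the
  weight \<open>(1 + t\<^sup>2) powr \<alpha>\<close> and leaves an integrable factor to spare.
\<close>

lemma plateau_weighted_decay:
  assumes "p < r" "\<alpha> \<ge> 0"
  shows "\<exists>\<phi> A. plateau p r \<phi> \<and> A \<ge> 0 \<and> (\<forall>t. (cmod (fourier_1d \<phi> t))\<^sup>2 * (1 + t\<^sup>2) powr \<alpha> \<le> A * inverse (1 + t\<^sup>2))"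
proof -
  define k where "k = nat \<lceil>\<alpha> + 1\<rceil>"
  have k: "\<alpha> + 1 \<le> real k" using assms(2) by (simp add: k_def)
  obtain \<phi> C where \<phi>: "plateau p r \<phi>" and C: "\<And>t. \<bar>t\<bar> ^ k * cmod (fourier_1d \<phi> t) \<le> C"
    using plateau_decay[OF assms(1), of k] by auto
  define D where "D = max C (LINT x|lborel. \<bar>\<phi> x\<bar>)"
  have D1: "\<bar>t\<bar> ^ k * cmod (fourier_1d \<phi> t) \<le> D" and D2: "cmod (fourier_1d \<phi> t) \<le> D" for t
    using C[of t] norm_fourier_1d_le[of \<phi> t] by (auto simp: D_def)
  have "(cmod (fourier_1d \<phi> t))\<^sup>2 * (1 + t\<^sup>2) powr \<alpha> \<le> 2 ^ k * D\<^sup>2 * inverse (1 + t\<^sup>2)" for t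
  proof -
    define c where "c = cmod (fourier_1d \<phi> t)"
    have c: "c \<ge> 0" "c \<le> D" "\<bar>t\<bar> ^ k * c \<le> D" using D1[of t] D2[of t] by (simp_all add: c_def)
    have pos: "1 + t\<^sup>2 > 0" by (simp add: add_pos_nonneg)
    have "c\<^sup>2 * (1 + t\<^sup>2) ^ k \<le> 2 ^ k * D\<^sup>2"
    proof (cases "\<bar>t\<bar> \<le> 1")
      case True
      then have "t\<^sup>2 \<le> 1" by (simp add: abs_square_le_1)
      then have "(1 + t\<^sup>2) ^ k \<le> 2 ^ k" by (intro power_mono) auto
      moreover have "c\<^sup>2 \<le> D\<^sup>2" using c by (intro power_mono) auto
      ultimately have "c\<^sup>2 * (1 + t\<^sup>2) ^ k \<le> D\<^sup>2 * 2 ^ k" by (intro mult_mono) auto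
      then show ?thesis by (simp add: mult.commute)
    next
      case False
      then have "1\<^sup>2 \<le> \<bar>t\<bar>\<^sup>2" by (intro power_mono) auto
      then have "1 \<le> t\<^sup>2" by simp
      then have "(1 + t\<^sup>2) ^ k \<le> (2 * t\<^sup>2) ^ k" by (intro power_mono) auto
      also have "\<dots> = 2 ^ k * (\<bar>t\<bar> ^ k)\<^sup>2"
        by (simp add: power_mult_distrib power2_eq_square flip: power_abs)
      finally have "c\<^sup>2 * (1 + t\<^sup>2) ^ k \<le> c\<^sup>2 * (2 ^ k * (\<bar>t\<bar> ^ k)\<^sup>2)" by (intro mult_left_mono) auto
      also have "\<dots> = 2 ^ k * (\<bar>t\<bar> ^ k * c)\<^sup>2" by (simp add: power_mult_distrib)
      also have "\<dots> \<le> 2 ^ k * D\<^sup>2" using c by (intro mult_left_mono power_mono) auto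
      finally show ?thesis .
    qed
    moreover have "(1 + t\<^sup>2) powr \<alpha> * (1 + t\<^sup>2) \<le> (1 + t\<^sup>2) ^ k"
    proof -
      have "(1 + t\<^sup>2) powr \<alpha> * (1 + t\<^sup>2) = (1 + t\<^sup>2) powr (\<alpha> + 1)"
        using pos by (simp add: powr_add)
      also have "\<dots> \<le> (1 + t\<^sup>2) powr (real k)" using k by (intro powr_mono) auto
      also have "\<dots> = (1 + t\<^sup>2) ^ k" using pos by (simp add: powr_realpow)
      finally show ?thesis .
    qed
    then have "c\<^sup>2 * ((1 + t\<^sup>2) powr \<alpha> * (1 + t\<^sup>2)) \<le> c\<^sup>2 * (1 + t\<^sup>2) ^ k" by (intro mult_left_mono) auto
    ultimately have "c\<^sup>2 * ((1 + t\<^sup>2) powr \<alpha> * (1 + t\<^sup>2)) \<le> 2 ^ k * D\<^sup>2" by (rule order_trans[rotated])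
    then show ?thesis using pos by (simp add: c_def field_simps)
  qed
  moreover have "2 ^ k * D\<^sup>2 \<ge> 0" by simp
  ultimately show ?thesis using \<phi> by blast
qed

text \<open>
  A bump in the Sobolev space of order \<open>\<alpha>\<close>, as a product of one-dimensional plateaus. It equals \<open>1\<close> on a
  cube containing the ball of radius \<open>p\<close>; its support is a cube contained in the ball of radius
  \<open>d * r\<close>. The Sobolev weight is dominated by the product of its one-dimensional versions, so the
  decay can be checked in each coordinate.
\<close>

lemma tensor_bump:
  assumes p: "p < r" and \<alpha>: "\<alpha> \<ge> 0"
  obtains g H :: "real ^ 'd \<Rightarrow> real" and B
  where "continuous_on UNIV g" "integrable lborel g" "\<And>x. \<bar>g x\<bar> \<le> B"
    and "\<And>x. norm x \<le> p \<Longrightarrow> g x = 1"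
    and "\<And>x. norm x \<ge> real CARD('d) * r \<Longrightarrow> g x = 0"
    and "integrable lborel H"
    and "\<And>\<xi>. (cmod (fourier_transform g \<xi>))\<^sup>2 * (1 + (norm \<xi>)\<^sup>2) powr \<alpha> \<le> H \<xi>"
proof -
  obtain \<phi> A where \<phi>: "plateau p r \<phi>" and A: "A \<ge> 0"
    "\<And>t. (cmod (fourier_1d \<phi> t))\<^sup>2 * (1 + t\<^sup>2) powr \<alpha> \<le> A * inverse (1 + t\<^sup>2)"
    using plateau_weighted_decay[OF p \<alpha>] by blast
  obtain B where B: "B > 0" "\<And>t. \<bar>\<phi> t\<bar> \<le> B" using plateau_bounded[OF \<phi>] by metis
  note int = plateau_integrable[OF \<phi>]
  define g :: "real^'d \<Rightarrow> real" where "g = (\<lambda>x. \<Prod>b\<in>Basis. \<phi> (inner x b))"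
  define H :: "real^'d \<Rightarrow> real" where "H = (\<lambda>\<xi>. \<Prod>b\<in>Basis. A * inverse (1 + (inner \<xi> b)\<^sup>2))"
  have cont: "continuous_on UNIV g"
  proof -
    have "continuous_on UNIV \<phi>" using \<phi> by (simp add: plateau_def)
    then have "continuous_on UNIV (\<lambda>x. \<phi> (inner x b))" for b :: "real^'d"
      by (rule continuous_on_compose2) (auto intro: continuous_intros)
    then show ?thesis unfolding g_def by (rule continuous_on_prod)
  qed
  have g_int: "integrable lborel g"
    unfolding g_def by (rule lborel_integrable_prod(1)) (rule int)
  have bdd: "\<bar>g x\<bar> \<le> (\<Prod>b\<in>(Basis :: (real^'d) set). B)" for x
    unfolding g_def abs_prod by (intro prod_mono) (simp add: B)
  have one: "g x = 1" if "norm x \<le> p" for x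
  proof -
    have "\<bar>inner x b\<bar> \<le> p" if "b \<in> Basis" for b
      using Basis_le_norm[OF that, of x] \<open>norm x \<le> p\<close> by simp
    then show ?thesis using \<phi> by (simp add: g_def plateau_def)
  qed
  have zero: "g x = 0" if x: "norm x \<ge> real CARD('d) * r" for x
  proof -
    have "\<exists>b\<in>Basis. r \<le> \<bar>inner x b\<bar>"
    proof (rule ccontr)
      assume "\<not> ?thesis"
      then have "(\<Sum>b\<in>Basis. \<bar>inner x b\<bar>) < (\<Sum>b\<in>(Basis :: (real^'d) set). r)"
        by (intro sum_strict_mono) (auto simp: not_le)
      then show False using x norm_le_l1[of x] by simp
    qed
    then show ?thesis using \<phi> by (auto simp: g_def plateau_def)
  qed
  have H_int: "integrable lborel H"
  proof -
    have "integrable lborel (\<lambda>t::real. inverse (1 + t\<^sup>2))"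
      using integrable_inverse_1_plus_square by (simp add: set_integrable_def)
    then show ?thesis
      unfolding H_def by (intro lborel_integrable_prod(1) integrable_mult_right)
  qed
  have "(cmod (fourier_transform g \<xi>))\<^sup>2 * (1 + (norm \<xi>)\<^sup>2) powr \<alpha> \<le> H \<xi>" for \<xi>
  proof -
    have int_b: "integrable lborel (\<lambda>t. complex_of_real (\<phi> t) * iexp (- (s * t)))" for s
    proof (rule Bochner_Integration.integrable_bound[OF int])
      show "(\<lambda>t. complex_of_real (\<phi> t) * iexp (- (s * t))) \<in> borel_measurable lborel"
        using borel_measurable_integrable[OF int] by measurable
    qed (simp add: norm_mult)
    have "fourier_transform g \<xi> = (LINT x|lborel. (\<Prod>b\<in>Basis. complex_of_real (\<phi> (inner x b)) * iexp (- (inner \<xi> b * inner x b))))"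
      unfolding fourier_transform_def
    proof (intro Bochner_Integration.integral_cong refl)
      fix x
      have "exp (- (\<i> * complex_of_real (inner \<xi> x))) = (\<Prod>b\<in>Basis. iexp (- (inner \<xi> b * inner x b)))"
        by (subst euclidean_inner) (simp add: exp_sum[symmetric] sum_distrib_left sum_negf)
      then show "complex_of_real (g x) * exp (- (\<i> * complex_of_real (inner \<xi> x)))
          = (\<Prod>b\<in>Basis. complex_of_real (\<phi> (inner x b)) * iexp (- (inner \<xi> b * inner x b)))"
        by (simp add: g_def prod.distrib)
    qed
    also have "\<dots> = (\<Prod>b\<in>Basis. fourier_1d \<phi> (inner \<xi> b))"
      unfolding fourier_1d_def by (rule lborel_integrable_prod(2)) (rule int_b)
    finally have "(cmod (fourier_transform g \<xi>))\<^sup>2 = (\<Prod>b\<in>Basis. (cmod (fourier_1d \<phi> (inner \<xi> b)))\<^sup>2)"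
      by (simp add: prod_norm[symmetric] prod_power_distrib)
    moreover have "(1 + (norm \<xi>)\<^sup>2) powr \<alpha> \<le> (\<Prod>b\<in>Basis. (1 + (inner \<xi> b)\<^sup>2) powr \<alpha>)"
    proof -
      \<comment> \<open>Expanding the product gives \<open>1\<close>, the sum, and further nonnegative terms.\<close>
      have expand: "1 + sum a S \<le> (\<Prod>b\<in>S. 1 + a b)" if "finite S" "\<And>b. a b \<ge> 0" for S and a :: "real^'d \<Rightarrow> real"
        using that
      proof (induction S rule: finite_induct)
        case (insert b S)
        have "1 \<le> (\<Prod>b\<in>S. 1 + a b)" using insert by (intro prod_ge_1) auto
        then have "a b * 1 \<le> a b * (\<Prod>b\<in>S. 1 + a b)" using insert by (intro mult_left_mono) auto
        then show ?case using insert by (simp add: distrib_right)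
      qed simp
      have "(norm \<xi>)\<^sup>2 = (\<Sum>b\<in>Basis. (inner \<xi> b)\<^sup>2)"
        unfolding power2_norm_eq_inner by (subst euclidean_inner) (simp add: power2_eq_square)
      then have "1 + (norm \<xi>)\<^sup>2 \<le> (\<Prod>b\<in>Basis. 1 + (inner \<xi> b)\<^sup>2)"
        using expand[of "Basis :: (real^'d) set" "\<lambda>b. (inner \<xi> b)\<^sup>2"] by simp
      then have "(1 + (norm \<xi>)\<^sup>2) powr \<alpha> \<le> (\<Prod>b\<in>Basis. 1 + (inner \<xi> b)\<^sup>2) powr \<alpha>"
        using \<alpha> by (intro powr_mono2) auto
      then show ?thesis by (simp add: prod_powr_distrib)
    qed
    ultimately have "(cmod (fourier_transform g \<xi>))\<^sup>2 * (1 + (norm \<xi>)\<^sup>2) powr \<alpha>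
        \<le> (\<Prod>b\<in>Basis. (cmod (fourier_1d \<phi> (inner \<xi> b)))\<^sup>2) * (\<Prod>b\<in>Basis. (1 + (inner \<xi> b)\<^sup>2) powr \<alpha>)"
      by (simp add: mult_left_mono prod_nonneg)
    also have "\<dots> \<le> H \<xi>"
      unfolding H_def prod.distrib[symmetric] by (intro prod_mono conjI A(2)) auto
    finally show ?thesis .
  qed
  with cont g_int bdd one zero H_int show ?thesis by (rule that)
qed

section \<open>Conditional mean and variance for a positive-definite kernel\<close>

lemma positive_definite_kernel_pos:
  fixes N :: nat
  assumes "positive_definite_kernel K" "inj_on x {..<N}" "\<exists>i<N. a i \<noteq> 0"
  shows "0 < (\<Sum>i<N. \<Sum>j<N. a i * a j * K (x i) (x j))"
proof -
  have "\<forall>(N::nat) a z. (\<exists>i<N. a i \<noteq> 0) \<longrightarrow> inj_on z {..<N} \<longrightarrow> (\<Sum>i<N. \<Sum>j<N. a i * a j * K (z i) (z j)) > 0"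
    using assms(1) unfolding positive_definite_kernel_def by (rule conjunct2)
  from this[THEN spec, of N, THEN spec, of a, THEN spec, of x] show ?thesis using assms(2,3) by simp
qed

lemma positive_definite_kernel_nonneg:
  fixes N :: nat
  assumes K: "positive_definite_kernel K" and x: "inj_on x {..<N}"
  shows "0 \<le> (\<Sum>i<N. \<Sum>j<N. a i * a j * K (x i) (x j))"
proof (cases "\<exists>i<N. a i \<noteq> 0")
  case True
  then have "0 < (\<Sum>i<N. \<Sum>j<N. a i * a j * K (x i) (x j))"
    by (rule positive_definite_kernel_pos[OF K x])
  then show ?thesis by simp
next
  case False
  then show ?thesis by simp
qed

text \<open>
  A kernel vector would violate strict positive definiteness, so the kernel matrix is invertible and
  \<^const>\<open>mat_inverse\<close> returns its inverse.
\<close>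

lemma kernel_matrix_inverse:
  assumes K: "positive_definite_kernel K" and x: "inj_on x {..<N}"
  shows "kernel_matrix_inv K N x \<in> carrier_mat N N"
    and "kernel_matrix K N x * kernel_matrix_inv K N x = 1\<^sub>m N"
proof -
  let ?A = "kernel_matrix K N x"
  have A: "?A \<in> carrier_mat N N" by (simp add: kernel_matrix_def)
  have "Determinant.det ?A \<noteq> 0"
  proof
    assume "Determinant.det ?A = 0"
    then obtain v where v: "v \<in> carrier_vec N" "v \<noteq> 0\<^sub>v N" "?A *\<^sub>v v = 0\<^sub>v N"
      using det_0_iff_vec_prod_zero[OF A] by auto
    let ?a = "vec_index v"
    have row: "(\<Sum>j<N. K (x i) (x j) * ?a j) = 0" if "i < N" for i
    proof -
      have "vec_index (?A *\<^sub>v v) i = (\<Sum>j<N. K (x i) (x j) * ?a j)"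
        using v(1) that by (simp add: kernel_matrix_def scalar_prod_def lessThan_atLeast0)
      then show ?thesis using v(3) that by simp
    qed
    have "\<exists>i<N. ?a i \<noteq> 0" using v(1,2) by (auto simp: vec_eq_iff)
    then have "0 < (\<Sum>i<N. \<Sum>j<N. ?a i * ?a j * K (x i) (x j))"
      by (rule positive_definite_kernel_pos[OF K x])
    also have "\<dots> = (\<Sum>i<N. ?a i * (\<Sum>j<N. K (x i) (x j) * ?a j))"
      by (simp add: sum_distrib_left mult_ac)
    also have "\<dots> = 0" by (simp add: row)
    finally show False by simp
  qed
  then have "?A \<in> Units (ring_mat TYPE(real) N ())" by (rule det_non_zero_imp_unit[OF A])
  then obtain B where "mat_inverse ?A = Some B"
    using mat_inverse(1)[OF A, of "()"] by (cases "mat_inverse ?A") auto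
  then show "kernel_matrix_inv K N x \<in> carrier_mat N N" "?A * kernel_matrix_inv K N x = 1\<^sub>m N"
    using mat_inverse(2)[OF A] by (auto simp: kernel_matrix_inv_def)
qed

text \<open>
  The weights \<open>w\<close> solve the normal equations. By symmetry of the kernel matrix the inverse can be
  moved from the data vector to the kernel vector, which makes the conditional mean a
  weighted sum of the data with weights that depend on the sites only.
\<close>

lemma kernel_weights:
  assumes K: "positive_definite_kernel K" and x: "inj_on x {..<N}"
  obtains w where "\<And>i. i < N \<Longrightarrow> (\<Sum>j<N. K (x i) (x j) * w j) = K z (x i)"
    and "cond_sd K N x z = sqrt (K z z - (\<Sum>i<N. w i * K z (x i)))"
    and "\<And>m y. cond_mean m K N x y z = m z + (\<Sum>i<N. w i * (y i - m (x i)))"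
proof -
  let ?A = "kernel_matrix K N x" and ?B = "kernel_matrix_inv K N x" and ?k = "kernel_vector K N x z"
  have A: "?A \<in> carrier_mat N N" by (simp add: kernel_matrix_def)
  note B = kernel_matrix_inverse[OF K x]
  have k: "?k \<in> carrier_vec N" by (simp add: kernel_vector_def)
  define v where "v = ?B *\<^sub>v ?k"
  have v: "v \<in> carrier_vec N" using B(1) k by (simp add: v_def)
  have Av: "?A *\<^sub>v v = ?k"
    unfolding v_def using B k by (simp flip: assoc_mult_mat_vec[OF A B(1) k])
  have sym: "transpose_mat ?A = ?A"
    using K by (intro eq_matI) (auto simp: kernel_matrix_def positive_definite_kernel_def)
  have "(\<Sum>j<N. K (x i) (x j) * vec_index v j) = K z (x i)" if "i < N" for i
  proof -
    have "vec_index (?A *\<^sub>v v) i = (\<Sum>j<N. K (x i) (x j) * vec_index v j)"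
      using v that by (simp add: kernel_matrix_def scalar_prod_def lessThan_atLeast0)
    then show ?thesis using that by (simp add: Av kernel_vector_def)
  qed
  moreover have "cond_sd K N x z = sqrt (K z z - (\<Sum>i<N. vec_index v i * K z (x i)))"
    using v unfolding cond_sd_def v_def[symmetric]
    by (simp add: kernel_vector_def scalar_prod_def lessThan_atLeast0 mult.commute)
  moreover have "cond_mean m K N x y z = m z + (\<Sum>i<N. vec_index v i * (y i - m (x i)))" for m y
  proof -
    let ?y = "Matrix.vec N (\<lambda>i. y i - m (x i))"
    have y: "?y \<in> carrier_vec N" by simp
    have By: "?B *\<^sub>v ?y \<in> carrier_vec N" using B(1) by simp
    have "scalar_prod ?k (?B *\<^sub>v ?y) = scalar_prod (transpose_mat ?A *\<^sub>v v) (?B *\<^sub>v ?y)"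
      by (simp add: Av sym)
    also have "\<dots> = scalar_prod v (?A *\<^sub>v (?B *\<^sub>v ?y))"
      by (rule transpose_vec_mult_scalar[OF A By v])
    also have "?A *\<^sub>v (?B *\<^sub>v ?y) = ?y"
      using B y by (simp flip: assoc_mult_mat_vec[OF A B(1) y])
    finally show ?thesis
      by (simp add: cond_mean_def scalar_prod_def lessThan_atLeast0)
  qed
  ultimately show ?thesis by (rule that)
qed

text \<open>
  The conditional variance at \<open>z\<close> is the kernel quadratic form at the \<open>N + 1\<close> points \<open>x 0, \<dots>, x (N - 1), z\<close>
  with coefficients \<open>- w i\<close> and \<open>1\<close>; this is the form to which the evaluation bound applies. The
  weights minimise that form, so predicting from a single site \<open>x i\<close> can only do worse.
\<close>

lemma conditional_variance_quadratic_form: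
  assumes K: "positive_definite_kernel K" and x: "inj_on x {..<N}" and z: "z \<notin> x ` {..<N}"
  obtains w where
    "\<And>m y. cond_mean m K N x y z = m z + (\<Sum>i<N. w i * (y i - m (x i)))"
    and "(cond_sd K N x z)\<^sup>2 = (\<Sum>i<Suc N. \<Sum>j<Suc N. (if i < N then - w i else 1) * (if j < N then - w j else 1)
            * K (if i < N then x i else z) (if j < N then x j else z))"
    and "0 < (cond_sd K N x z)\<^sup>2"
    and "\<And>i. i < N \<Longrightarrow> (cond_sd K N x z)\<^sup>2 \<le> K z z - 2 * K z (x i) + K (x i) (x i)"
proof -
  obtain w where w: "\<And>i. i < N \<Longrightarrow> (\<Sum>j<N. K (x i) (x j) * w j) = K z (x i)"
    and sd: "cond_sd K N x z = sqrt (K z z - (\<Sum>i<N. w i * K z (x i)))"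
    and mean: "\<And>m y. cond_mean m K N x y z = m z + (\<Sum>i<N. w i * (y i - m (x i)))"
    by (rule kernel_weights[OF K x, where z = z]) (rule that)
  define V where "V = K z z - (\<Sum>i<N. w i * K z (x i))"
  define b where "b = (\<lambda>i. if i < N then - w i else 1)"
  define p where "p = (\<lambda>i. if i < N then x i else z)"
  have sym: "K u v = K v u" for u v using K by (simp add: positive_definite_kernel_def)
  \<comment> \<open>The normal equations make every row of the form vanish except the one belonging to \<open>z\<close>.\<close>
  have "(\<Sum>j<Suc N. b i * b j * K (p i) (p j)) = (if i = N then V else 0)" if "i < Suc N" for i
  proof (cases "i = N")
    case True
    then show ?thesis by (simp add: b_def p_def V_def sum_negf)
  next
    case False
    then have i: "i < N" using that by simp
    then have "(\<Sum>j<Suc N. b i * b j * K (p i) (p j)) = w i * ((\<Sum>j<N. K (x i) (x j) * w j) - K z (x i))"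
      by (simp add: b_def p_def sym[of _ z] sum_distrib_left algebra_simps)
    then show ?thesis using w[OF i] i by simp
  qed
  then have form: "(\<Sum>i<Suc N. \<Sum>j<Suc N. b i * b j * K (p i) (p j)) = V"
    by simp
  have "inj_on p {..<Suc N}"
    using x z by (auto simp: inj_on_def p_def less_Suc_eq)
  moreover have "\<exists>i<Suc N. b i \<noteq> 0" by (auto simp: b_def)
  ultimately have "0 < V"
    unfolding form[symmetric] by (rule positive_definite_kernel_pos[OF K])
  then have sq: "(cond_sd K N x z)\<^sup>2 = V" by (simp add: sd V_def)
  have "V \<le> K z z - 2 * K z (x i) + K (x i) (x i)" if i: "i < N" for i
  proof -
    let ?e = "\<lambda>j. if j = i then 1 else 0 :: real"
    \<comment> \<open>The excess of the single-site predictor over \<open>V\<close> is the form at the difference of the weights.\<close>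
    have "0 \<le> (\<Sum>j<N. \<Sum>l<N. (?e j - w j) * (?e l - w l) * K (x j) (x l))"
      by (rule positive_definite_kernel_nonneg[OF K x])
    also have "\<dots> = (\<Sum>j<N. (?e j - w j) * (K (x j) (x i) - K z (x j)))"
    proof (intro sum.cong refl)
      fix j assume j: "j \<in> {..<N}"
      have "(\<Sum>l<N. (?e j - w j) * (?e l - w l) * K (x j) (x l))
          = (?e j - w j) * ((\<Sum>l<N. ?e l * K (x j) (x l)) - (\<Sum>l<N. K (x j) (x l) * w l))"
        by (simp add: sum_subtractf[symmetric] sum_distrib_left algebra_simps)
      also have "(\<Sum>l<N. ?e l * K (x j) (x l)) = K (x j) (x i)"
        using i by (simp add: if_distrib[of "\<lambda>u. u * _"] cong: if_cong)
      finally show "(\<Sum>l<N. (?e j - w j) * (?e l - w l) * K (x j) (x l)) = (?e j - w j) * (K (x j) (x i) - K z (x j))"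
        using w j by simp
    qed
    also have "\<dots> = (\<Sum>j<N. ?e j * (K (x j) (x i) - K z (x j))) - (\<Sum>j<N. K (x i) (x j) * w j) + (\<Sum>j<N. w j * K z (x j))"
      unfolding sum_subtractf[symmetric] sum.distrib[symmetric]
    proof (intro sum.cong refl)
      fix j
      have "K (x i) (x j) = K (x j) (x i)" by (rule sym)
      then show "(?e j - w j) * (K (x j) (x i) - K z (x j))
          = ?e j * (K (x j) (x i) - K z (x j)) - K (x i) (x j) * w j + w j * K z (x j)"
        by (simp only:) (simp add: algebra_simps del: if_split)
    qed
    also have "(\<Sum>j<N. ?e j * (K (x j) (x i) - K z (x j))) = K (x i) (x i) - K z (x i)"
      using i by (simp add: if_distrib[of "\<lambda>u. u * _"] cong: if_cong)
    finally show ?thesis using w[OF i] by (simp add: V_def)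
  qed
  with mean form \<open>0 < V\<close> sq show ?thesis unfolding b_def p_def by (intro that[of w]) simp_all
qed

section \<open>Leave-one-out prediction across length scales\<close>

text \<open>
  The lower bound on the transform of \<open>\<Phi>\<close> says that the Hilbert space of the kernel contains the
  Sobolev space of order \<open>\<alpha>\<close>, hence all these bumps.
\<close>

lemma bump_evaluation_bound:
  fixes \<Phi> :: "real ^ 'd \<Rightarrow> real"
  assumes \<Phi>: "integrable lborel \<Phi>" "continuous_on UNIV \<Phi>" "\<And>x. \<bar>\<Phi> x\<bar> \<le> B"
    and real: "\<And>\<xi>. fourier_transform \<Phi> \<xi> \<in> \<real>"
    and lower: "\<And>\<xi>. c * (1 + (norm \<xi>)\<^sup>2) powr (- \<alpha>) \<le> Re (fourier_transform \<Phi> \<xi>)"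
    and c: "c > 0" and \<alpha>: "\<alpha> \<ge> 0" and p: "p < r"
  obtains g C where "\<And>x. norm x \<le> p \<Longrightarrow> g x = 1" "\<And>x. norm x \<ge> real CARD('d) * r \<Longrightarrow> g x = 0" "C > 0"
    and "\<And>(N::nat) b z. (\<Sum>i<N. b i * g (z i))\<^sup>2 \<le> C * (\<Sum>i<N. \<Sum>j<N. b i * b j * \<Phi> (z i - z j))"
proof -
  obtain g H :: "real ^ 'd \<Rightarrow> real" and Bg
    where g: "continuous_on UNIV g" "integrable lborel g" "\<And>x. \<bar>g x\<bar> \<le> Bg"
      and one: "\<And>x. norm x \<le> p \<Longrightarrow> g x = 1"
      and zero: "\<And>x. norm x \<ge> real CARD('d) * r \<Longrightarrow> g x = 0"
      and H: "integrable lborel H"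
      and decay: "\<And>\<xi>. (cmod (fourier_transform g \<xi>))\<^sup>2 * (1 + (norm \<xi>)\<^sup>2) powr \<alpha> \<le> H \<xi>"
    by (rule tensor_bump[OF p \<alpha>, where 'd = 'd]) (rule that)
  have wpos: "0 < (1 + (norm \<xi>)\<^sup>2) powr s" for \<xi> :: "real^'d" and s
  proof -
    have "0 < 1 + (norm \<xi>)\<^sup>2" by (simp add: add_pos_nonneg)
    then show ?thesis by simp
  qed
  have pos: "Re (fourier_transform \<Phi> \<xi>) > 0" for \<xi>
    using lower[of \<xi>] mult_pos_pos[OF c wpos[of \<xi> "- \<alpha>"]] by simp
  have g_decay: "(cmod (fourier_transform g \<xi>))\<^sup>2 \<le> H \<xi> / c * Re (fourier_transform \<Phi> \<xi>)" for \<xi>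
  proof -
    have H0: "0 \<le> H \<xi>" by (rule order_trans[OF _ decay]) simp
    have "(cmod (fourier_transform g \<xi>))\<^sup>2 \<le> H \<xi> * (1 + (norm \<xi>)\<^sup>2) powr (- \<alpha>)"
      using decay[of \<xi>] wpos[of \<xi> \<alpha>] by (simp add: powr_minus field_simps)
    also have "\<dots> = H \<xi> / c * (c * (1 + (norm \<xi>)\<^sup>2) powr (- \<alpha>))" using c by simp
    also have "\<dots> \<le> H \<xi> / c * Re (fourier_transform \<Phi> \<xi>)"
      using H0 c by (intro mult_left_mono lower) simp
    finally show ?thesis .
  qed
  have Hc: "integrable lborel (\<lambda>\<xi>. H \<xi> / c)" using H by simp
  obtain C where "C > 0"
    and "\<And>(I :: nat set) b z. (\<Sum>i\<in>I. b i * g (z i))\<^sup>2 \<le> C * (\<Sum>i\<in>I. \<Sum>j\<in>I. b i * b j * \<Phi> (z i - z j))"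
    by (rule evaluation_bound[OF \<Phi> real pos g(2,1,3) Hc g_decay, where 'i = nat]) (rule that)
  with one zero show ?thesis by (rule that)
qed

lemma scaled_kernel_positive_definite:
  assumes \<Phi>: "positive_definite_kernel (translation_kernel \<Phi>)" and l: "l > 0"
  shows "positive_definite_kernel (scaled_kernel \<Phi> l)"
proof -
  have scale: "scaled_kernel \<Phi> l u v = translation_kernel \<Phi> (u /\<^sub>R l) (v /\<^sub>R l)" for u v
    by (simp add: scaled_kernel_def translation_kernel_def scaleR_diff_right)
  have sym: "translation_kernel \<Phi> u v = translation_kernel \<Phi> v u" for u v
    using \<Phi> by (simp add: positive_definite_kernel_def)
  show ?thesis
    unfolding positive_definite_kernel_def scale
  proof (intro conjI allI impI)
    fix N and a :: "nat \<Rightarrow> real" and z :: "nat \<Rightarrow> real^'a"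
    assume a: "\<exists>i<N. a i \<noteq> 0" and z: "inj_on z {..<N}"
    have "inj_on (\<lambda>i. z i /\<^sub>R l) {..<N}" using z l by (simp add: inj_on_def)
    then show "0 < (\<Sum>i<N. \<Sum>j<N. a i * a j * translation_kernel \<Phi> (z i /\<^sub>R l) (z j /\<^sub>R l))"
      by (rule positive_definite_kernel_pos[OF \<Phi> _ a])
  qed (rule sym)
qed

text \<open>
  Positivity of the form at the two sites \<open>x\<close> and \<open>0\<close> with coefficients \<open>1\<close> and \<open>\<plusminus>1\<close>.
\<close>

lemma positive_definite_translation_bounded:
  assumes \<Phi>: "positive_definite_kernel (translation_kernel \<Phi>)"
  shows "\<bar>\<Phi> x\<bar> \<le> \<Phi> 0"
proof (cases "x = 0")
  case True
  have "0 < (\<Sum>i<1::nat. \<Sum>j<1::nat. 1 * 1 * translation_kernel \<Phi> 0 0)"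
    by (rule positive_definite_kernel_pos[OF \<Phi>]) (auto simp: inj_on_def)
  then show ?thesis using True by (simp add: translation_kernel_def)
next
  case False
  have "translation_kernel \<Phi> 0 x = translation_kernel \<Phi> x 0"
    using \<Phi> by (simp add: positive_definite_kernel_def)
  then have sym: "\<Phi> (- x) = \<Phi> x" by (simp add: translation_kernel_def)
  have "0 \<le> 2 * \<Phi> 0 + 2 * s * \<Phi> x" if "s\<^sup>2 = 1" for s :: real
  proof -
    let ?a = "\<lambda>i::nat. if i = 0 then 1 else s" and ?z = "\<lambda>i::nat. if i = 0 then x else 0"
    have "0 \<le> (\<Sum>i<2::nat. \<Sum>j<2::nat. ?a i * ?a j * translation_kernel \<Phi> (?z i) (?z j))"
      by (rule positive_definite_kernel_nonneg[OF \<Phi>]) (use False in \<open>auto simp: inj_on_def\<close>)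
    then show ?thesis
      using that by (simp add: numeral_2_eq_2 translation_kernel_def sym power2_eq_square)
  qed
  from this[of 1] this[of "-1"] show ?thesis by simp
qed

lemma insert_index_sites:
  assumes x: "inj_on x {..<n}" and k: "k < n"
  shows "inj_on (x \<circ> insert_index k) {..<n - 1}" and "x k \<notin> (x \<circ> insert_index k) ` {..<n - 1}"
    and "i < n - 1 \<Longrightarrow> insert_index k i < n" and "insert_index k i \<noteq> k"
    and "j < n \<Longrightarrow> j \<noteq> k \<Longrightarrow> \<exists>i<n - 1. insert_index k i = j"
proof -
  have lt: "insert_index k i < n" if "i < n - 1" for i using that k by (auto simp: insert_index_def)
  have ne: "insert_index k i \<noteq> k" for i by (auto simp: insert_index_def)
  have inj: "inj (insert_index k)" by (rule inj_on_inverseI[of _ "delete_index k"]) simp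
  show "i < n - 1 \<Longrightarrow> insert_index k i < n" by (rule lt)
  show "insert_index k i \<noteq> k" by (rule ne)
  show "inj_on (x \<circ> insert_index k) {..<n - 1}"
  proof (rule comp_inj_on)
    show "inj_on (insert_index k) {..<n - 1}" by (rule inj_on_subset[OF inj]) simp
    show "inj_on x (insert_index k ` {..<n - 1})" by (rule inj_on_subset[OF x]) (use lt in auto)
  qed
  show "x k \<notin> (x \<circ> insert_index k) ` {..<n - 1}"
  proof
    assume "x k \<in> (x \<circ> insert_index k) ` {..<n - 1}"
    then obtain i where i: "i < n - 1" "x k = x (insert_index k i)" by auto
    then have "k = insert_index k i" using inj_onD[OF x i(2)] lt k by simp
    then show False using ne[of i] by simp
  qed
  show "\<exists>i<n - 1. insert_index k i = j" if "j < n" "j \<noteq> k"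
    using that k insert_delete_index[of j k] by (intro exI[of _ "delete_index k j"]) (auto simp: delete_index_def)
qed

lemma loo_sd_sq_bounds:
  assumes \<Phi>: "positive_definite_kernel (translation_kernel \<Phi>)" and l: "l > 0"
    and x: "inj_on x {..<n}" and k: "k < n"
  shows "0 < (loo_sd (scaled_kernel \<Phi> l) n x k (x k))\<^sup>2"
    and "j < n \<Longrightarrow> j \<noteq> k \<Longrightarrow> (loo_sd (scaled_kernel \<Phi> l) n x k (x k))\<^sup>2 \<le> 2 * (\<Phi> 0 - \<Phi> ((x k - x j) /\<^sub>R l))"
proof -
  note sites = insert_index_sites[OF x k]
  note K = scaled_kernel_positive_definite[OF \<Phi> l]
  obtain w where pos: "0 < (cond_sd (scaled_kernel \<Phi> l) (n - 1) (x \<circ> insert_index k) (x k))\<^sup>2"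
    and le: "\<And>i. i < n - 1 \<Longrightarrow> (cond_sd (scaled_kernel \<Phi> l) (n - 1) (x \<circ> insert_index k) (x k))\<^sup>2
        \<le> scaled_kernel \<Phi> l (x k) (x k) - 2 * scaled_kernel \<Phi> l (x k) ((x \<circ> insert_index k) i)
          + scaled_kernel \<Phi> l ((x \<circ> insert_index k) i) ((x \<circ> insert_index k) i)"
    by (rule conditional_variance_quadratic_form[OF K sites(1,2)]) (rule that)
  show "0 < (loo_sd (scaled_kernel \<Phi> l) n x k (x k))\<^sup>2" using pos by (simp add: loo_sd_def)
  assume "j < n" "j \<noteq> k"
  then obtain i where "i < n - 1" "insert_index k i = j" using sites(5) by blast
  then show "(loo_sd (scaled_kernel \<Phi> l) n x k (x k))\<^sup>2 \<le> 2 * (\<Phi> 0 - \<Phi> ((x k - x j) /\<^sub>R l))"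
    using le[of i] by (simp add: loo_sd_def scaled_kernel_def)
qed

text \<open>
  Predicting the values of \<open>g\<close>, translated by \<open>t\<close> and stretched by \<open>l\<close>, from the other sites incurs an error
  of at most \<open>sqrt C\<close> conditional standard deviations, with a constant that serves all length scales
  and translations at once: both only move the points at which \<open>g\<close> is evaluated.
\<close>

lemma loo_evaluation_bound:
  assumes \<Phi>: "positive_definite_kernel (translation_kernel \<Phi>)" and l: "l > 0"
    and x: "inj_on x {..<n}" and k: "k < n"
    and ev: "\<And>(N::nat) b z. (\<Sum>i<N. b i * g (z i))\<^sup>2 \<le> C * (\<Sum>i<N. \<Sum>j<N. b i * b j * \<Phi> (z i - z j))"
  obtains w where
    "\<And>m y. loo_mean m (scaled_kernel \<Phi> l) n x y k (x k)
        = m (x k) + (\<Sum>i<n - 1. w i * (y (insert_index k i) - m (x (insert_index k i))))"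
    and "\<And>t. (g ((x k - t) /\<^sub>R l) - (\<Sum>i<n - 1. w i * g ((x (insert_index k i) - t) /\<^sub>R l)))\<^sup>2
        \<le> C * (loo_sd (scaled_kernel \<Phi> l) n x k (x k))\<^sup>2"
proof -
  let ?N = "n - 1" and ?x = "x \<circ> insert_index k" and ?K = "scaled_kernel \<Phi> l"
  obtain w where mean: "\<And>m y. cond_mean m ?K ?N ?x y (x k) = m (x k) + (\<Sum>i<?N. w i * (y i - m (?x i)))"
    and var: "(cond_sd ?K ?N ?x (x k))\<^sup>2 = (\<Sum>i<Suc ?N. \<Sum>j<Suc ?N. (if i < ?N then - w i else 1) * (if j < ?N then - w j else 1)
            * ?K (if i < ?N then ?x i else x k) (if j < ?N then ?x j else x k))"
    by (rule conditional_variance_quadratic_form[OF scaled_kernel_positive_definite[OF \<Phi> l] insert_index_sites(1,2)[OF x k]])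
      (rule that)
  define b where "b = (\<lambda>i. if i < ?N then - w i else 1)"
  define p where "p = (\<lambda>i. if i < ?N then ?x i else x k)"
  have "(g ((x k - t) /\<^sub>R l) - (\<Sum>i<?N. w i * g ((x (insert_index k i) - t) /\<^sub>R l)))\<^sup>2
        \<le> C * (loo_sd ?K n x k (x k))\<^sup>2" for t
  proof -
    let ?z = "\<lambda>i. (p i - t) /\<^sub>R l"
    have "g ((x k - t) /\<^sub>R l) - (\<Sum>i<?N. w i * g ((x (insert_index k i) - t) /\<^sub>R l)) = (\<Sum>i<Suc ?N. b i * g (?z i))"
      by (simp add: b_def p_def sum_negf)
    moreover have "\<Phi> (?z i - ?z j) = ?K (p i) (p j)" for i j
      by (simp add: scaled_kernel_def flip: scaleR_diff_right)
    ultimately show ?thesis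
      using ev[where N = "Suc ?N" and b = b and z = ?z] by (simp only: loo_sd_def var b_def p_def)
  qed
  moreover have "loo_mean m ?K n x y k (x k) = m (x k) + (\<Sum>i<?N. w i * (y (insert_index k i) - m (x (insert_index k i))))" for m y
    by (simp only: loo_mean_def mean o_apply)
  ultimately show ?thesis by (intro that[of w])
qed

section \<open>Asymptotics of the cross-validation objective\<close>

text \<open>
  For \<open>l \<le> M\<close> the rescaled sites stay a distance \<open>\<delta> / M\<close> apart. A narrow bump centred at the omitted site
  therefore vanishes at all the others, so its value \<open>1\<close> is predicted as \<open>0\<close>. This error
  forces the conditional variance to stay away from \<open>0\<close>.
\<close>

lemma loo_sd_sq_lower_bound:
  fixes \<Phi> :: "real ^ 'd \<Rightarrow> real"
  assumes pd: "positive_definite_kernel (translation_kernel \<Phi>)"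
    and \<Phi>: "integrable lborel \<Phi>" "continuous_on UNIV \<Phi>"
    and real: "\<And>\<xi>. fourier_transform \<Phi> \<xi> \<in> \<real>"
    and lower: "\<And>\<xi>. C\<^sub>1 * (1 + (norm \<xi>)\<^sup>2) powr (- \<alpha>) \<le> Re (fourier_transform \<Phi> \<xi>)"
    and C\<^sub>1: "C\<^sub>1 > 0" and \<alpha>: "\<alpha> \<ge> 0" and x: "inj_on x {..<n}" and M: "M > 0"
  shows "\<exists>\<epsilon>>0. \<forall>l k. 0 < l \<longrightarrow> l \<le> M \<longrightarrow> k < n \<longrightarrow> \<epsilon> \<le> (loo_sd (scaled_kernel \<Phi> l) n x k (x k))\<^sup>2"
proof -
  \<comment> \<open>The element \<open>1\<close> keeps the set nonempty when there is at most one site.\<close>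
  define S where "S = insert 1 ((\<lambda>(i, k). norm (x i - x k)) ` {(i, k) \<in> {..<n} \<times> {..<n}. i \<noteq> k})"
  define \<delta> where "\<delta> = Min S"
  have fin: "finite S" "S \<noteq> {}" by (auto simp: S_def intro: finite_subset[of _ "{..<n} \<times> {..<n}"])
  have "s > 0" if "s \<in> S" for s using that x by (auto simp: S_def inj_on_def)
  then have \<delta>: "\<delta> > 0" using fin by (simp add: \<delta>_def)
  have sep: "\<delta> \<le> norm (x i - x k)" if "i < n" "k < n" "i \<noteq> k" for i k
    unfolding \<delta>_def by (rule Min_le[OF fin(1)]) (use that in \<open>force simp: S_def\<close>)
  define r where "r = \<delta> / M / real CARD('d)"
  have r: "0 < r" "real CARD('d) * r = \<delta> / M" using \<delta> M by (simp_all add: r_def)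
  obtain g C where g: "\<And>u. norm u \<le> 0 \<Longrightarrow> g u = 1" "\<And>u. norm u \<ge> real CARD('d) * r \<Longrightarrow> g u = 0" and C: "C > 0"
    and ev: "\<And>(N::nat) b z. (\<Sum>i<N. b i * g (z i))\<^sup>2 \<le> C * (\<Sum>i<N. \<Sum>j<N. b i * b j * \<Phi> (z i - z j))"
    by (rule bump_evaluation_bound[OF \<Phi> positive_definite_translation_bounded[OF pd] real lower C\<^sub>1 \<alpha> r(1)]) (rule that)
  have "1 / C \<le> (loo_sd (scaled_kernel \<Phi> l) n x k (x k))\<^sup>2" if l: "0 < l" "l \<le> M" and k: "k < n" for l k
  proof -
    note sites = insert_index_sites[OF x k]
    obtain w where w: "\<And>t. (g ((x k - t) /\<^sub>R l) - (\<Sum>i<n - 1. w i * g ((x (insert_index k i) - t) /\<^sub>R l)))\<^sup>2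
        \<le> C * (loo_sd (scaled_kernel \<Phi> l) n x k (x k))\<^sup>2"
      by (rule loo_evaluation_bound[OF pd l(1) x k ev]) (rule that)
    have "g ((x (insert_index k i) - x k) /\<^sub>R l) = 0" if "i < n - 1" for i
    proof (rule g(2))
      have "\<delta> / M \<le> norm (x (insert_index k i) - x k) / l"
        using sep[OF sites(3)[OF that] k sites(4)] \<delta> M l by (intro frac_le) auto
      then show "real CARD('d) * r \<le> norm ((x (insert_index k i) - x k) /\<^sub>R l)"
        using l r(2) by (simp add: divide_inverse mult.commute)
    qed
    then have "1 \<le> C * (loo_sd (scaled_kernel \<Phi> l) n x k (x k))\<^sup>2"
      using w[of "x k"] g(1)[of 0] by simp
    then show ?thesis using C by (simp add: field_simps)
  qed
  then show ?thesis using C by (intro exI[of _ "1 / C"]) auto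
qed

text \<open>
  Once \<open>l\<close> exceeds the norms of all sites, the rescaled sites lie in the region where a fixed bump
  equals \<open>1\<close>. Constant data \<open>c\<close> are then \<open>c\<close> times the values of that bump, so their prediction error is
  comparable to the conditional standard deviation.
\<close>

lemma loo_standardized_residual_bound:
  fixes \<Phi> :: "real ^ 'd \<Rightarrow> real"
  assumes pd: "positive_definite_kernel (translation_kernel \<Phi>)"
    and \<Phi>: "integrable lborel \<Phi>" "continuous_on UNIV \<Phi>"
    and real: "\<And>\<xi>. fourier_transform \<Phi> \<xi> \<in> \<real>"
    and lower: "\<And>\<xi>. C\<^sub>1 * (1 + (norm \<xi>)\<^sup>2) powr (- \<alpha>) \<le> Re (fourier_transform \<Phi> \<xi>)"
    and C\<^sub>1: "C\<^sub>1 > 0" and \<alpha>: "\<alpha> \<ge> 0" and x: "inj_on x {..<n}"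
    and y: "m_constant m n x y"
  shows "\<exists>A R. \<forall>l k. R \<le> l \<longrightarrow> k < n \<longrightarrow>
     ((y k - loo_mean m (scaled_kernel \<Phi> l) n x y k (x k)) / loo_sd (scaled_kernel \<Phi> l) n x k (x k))\<^sup>2 \<le> A"
proof -
  obtain c where c: "\<And>i. i < n \<Longrightarrow> y i - m (x i) = c" using y by (auto simp: m_constant_def)
  obtain g C where g: "\<And>u. norm u \<le> 1 \<Longrightarrow> g u = 1"
    and ev: "\<And>(N::nat) b z. (\<Sum>i<N. b i * g (z i))\<^sup>2 \<le> C * (\<Sum>i<N. \<Sum>j<N. b i * b j * \<Phi> (z i - z j))"
    by (rule bump_evaluation_bound[where p = 1 and r = 2, OF \<Phi> positive_definite_translation_bounded[OF pd] real lower C\<^sub>1 \<alpha>])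
      (simp, rule that)
  define R where "R = 1 + (\<Sum>i<n. norm (x i))"
  have "((y k - loo_mean m (scaled_kernel \<Phi> l) n x y k (x k)) / loo_sd (scaled_kernel \<Phi> l) n x k (x k))\<^sup>2 \<le> c\<^sup>2 * C"
    if l: "R \<le> l" and k: "k < n" for l k
  proof -
    note sites = insert_index_sites[OF x k]
    have Rpos: "1 \<le> R" by (simp add: R_def sum_nonneg)
    then have l0: "l > 0" using l by simp
    obtain w where mean: "\<And>m y. loo_mean m (scaled_kernel \<Phi> l) n x y k (x k)
        = m (x k) + (\<Sum>i<n - 1. w i * (y (insert_index k i) - m (x (insert_index k i))))"
      and w: "\<And>t. (g ((x k - t) /\<^sub>R l) - (\<Sum>i<n - 1. w i * g ((x (insert_index k i) - t) /\<^sub>R l)))\<^sup>2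
        \<le> C * (loo_sd (scaled_kernel \<Phi> l) n x k (x k))\<^sup>2"
      by (rule loo_evaluation_bound[OF pd l0 x k ev]) (rule that)
    define V where "V = (loo_sd (scaled_kernel \<Phi> l) n x k (x k))\<^sup>2"
    have V: "V > 0" unfolding V_def by (rule loo_sd_sq_bounds(1)[OF pd l0 x k])
    have one: "g (x i /\<^sub>R l) = 1" if "i < n" for i
    proof (rule g)
      have "norm (x i) \<le> (\<Sum>i<n. norm (x i))" by (rule member_le_sum) (use that in auto)
      then have "norm (x i) \<le> l" using l by (simp add: R_def)
      then show "norm (x i /\<^sub>R l) \<le> 1" using l0 by (simp add: divide_inverse[symmetric] mult.commute[of "inverse l"])
    qed
    have "(1 - (\<Sum>i<n - 1. w i))\<^sup>2 \<le> C * V"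
      using w[of 0] one[OF k] one[OF sites(3)] by (simp add: V_def)
    moreover have "y k - loo_mean m (scaled_kernel \<Phi> l) n x y k (x k) = c * (1 - (\<Sum>i<n - 1. w i))"
      using c[OF k] c[OF sites(3)] by (simp add: mean algebra_simps sum_distrib_left)
    ultimately have "(y k - loo_mean m (scaled_kernel \<Phi> l) n x y k (x k))\<^sup>2 \<le> c\<^sup>2 * (C * V)"
      by (simp add: power_mult_distrib mult_left_mono)
    then show ?thesis using V by (simp add: power_divide V_def[symmetric] field_simps)
  qed
  then show ?thesis by blast
qed

text \<open>
  Prediction from one remaining site suffices: the rescaled sites merge and \<open>\<Phi>\<close> is continuous at \<open>0\<close>.
\<close>

lemma loo_sd_sq_tendsto_0:
  fixes \<Phi> :: "real ^ 'd \<Rightarrow> real"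
  assumes pd: "positive_definite_kernel (translation_kernel \<Phi>)" and \<Phi>: "continuous_on UNIV \<Phi>"
    and x: "inj_on x {..<n}" and n: "n \<ge> 2" and k: "k < n"
  shows "((\<lambda>l. (loo_sd (scaled_kernel \<Phi> l) n x k (x k))\<^sup>2) \<longlongrightarrow> 0) at_top"
proof (rule tendsto_sandwich)
  define j where "j = (if k = 0 then 1 else 0 :: nat)"
  have j: "j < n" "j \<noteq> k" using n by (auto simp: j_def)
  show "\<forall>\<^sub>F l in at_top. 0 \<le> (loo_sd (scaled_kernel \<Phi> l) n x k (x k))\<^sup>2" by simp
  show "\<forall>\<^sub>F l in at_top. (loo_sd (scaled_kernel \<Phi> l) n x k (x k))\<^sup>2 \<le> 2 * (\<Phi> 0 - \<Phi> (inverse l *\<^sub>R (x k - x j)))"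
    using eventually_gt_at_top[of 0] by eventually_elim (rule loo_sd_sq_bounds(2)[OF pd _ x k j])
  have "((\<lambda>l::real. inverse l *\<^sub>R (x k - x j)) \<longlongrightarrow> 0 *\<^sub>R (x k - x j)) at_top"
    by (rule tendsto_scaleR[OF tendsto_inverse_0_at_top[OF filterlim_ident] tendsto_const])
  moreover have "isCont \<Phi> 0" using \<Phi> by (simp add: continuous_on_eq_continuous_at)
  ultimately have "((\<lambda>l. \<Phi> (inverse l *\<^sub>R (x k - x j))) \<longlongrightarrow> \<Phi> 0) at_top"
    by (auto intro: isCont_tendsto_compose[of 0 \<Phi>])
  then have "((\<lambda>l. 2 * (\<Phi> 0 - \<Phi> (inverse l *\<^sub>R (x k - x j)))) \<longlongrightarrow> 2 * (\<Phi> 0 - \<Phi> 0)) at_top"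
    by (intro tendsto_intros)
  then show "((\<lambda>l. 2 * (\<Phi> 0 - \<Phi> (inverse l *\<^sub>R (x k - x j)))) \<longlongrightarrow> 0) at_top" by simp
qed simp

text \<open>
  The infimum is \<open>-\<infinity>\<close> by the first hypothesis, and by the second no bounded range of arguments can
  approach it.
\<close>

lemma argmin_is_infinityI:
  assumes lim: "filterlim f at_bot at_top"
    and below: "\<And>M. M > 0 \<Longrightarrow> \<exists>c. \<forall>l. 0 < l \<longrightarrow> l \<le> M \<longrightarrow> c \<le> f l"
  shows "argmin_is_infinity f"
  unfolding argmin_is_infinity_def
proof (intro allI impI)
  fix l :: "nat \<Rightarrow> real"
  assume l: "\<forall>j. 0 < l j" and conv: "(\<lambda>j. ereal (f (l j))) \<longlonglongrightarrow> (INF t\<in>{0<..}. ereal (f t))"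
  have inf: "(INF t\<in>{0<..}. ereal (f t)) \<le> ereal z" for z
  proof -
    have "eventually (\<lambda>t. f t \<le> z \<and> 0 < t) at_top"
      using lim eventually_gt_at_top[of 0] by (auto simp: filterlim_at_bot intro: eventually_conj)
    then obtain t where "f t \<le> z" "0 < t" by (auto simp: eventually_at_top_linorder)
    then show ?thesis by (intro INF_lower2[of t]) auto
  qed
  show "filterlim l at_top sequentially"
    unfolding filterlim_at_top_gt[where c = 0]
  proof (intro allI impI)
    fix M :: real assume "0 < M"
    then obtain c where c: "\<And>l. 0 < l \<Longrightarrow> l \<le> M \<Longrightarrow> c \<le> f l" using below by blast
    have "(INF t\<in>{0<..}. ereal (f t)) < ereal c"
      by (rule le_less_trans[OF inf[of "c - 1"]]) simp
    then have "\<forall>\<^sub>F j in sequentially. ereal (f (l j)) < ereal c"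
      by (rule order_tendstoD(2)[OF conv])
    then show "\<forall>\<^sub>F j in sequentially. M \<le> l j"
    proof eventually_elim
      case (elim j)
      then show ?case using c[of "l j"] l by (cases "l j \<le> M") auto
    qed
  qed
qed

theorem theorem3p1:
  fixes n :: nat
    and x :: "nat \<Rightarrow> real ^ 'd"
    and m :: "real ^ 'd \<Rightarrow> real"
    and y :: "nat \<Rightarrow> real"
    and \<Phi> :: "real ^ 'd \<Rightarrow> real"
    and C1 C2 \<alpha> :: real
  assumes "n \<ge> 2"
    and "inj_on x {..<n}"
    and "positive_definite_kernel (translation_kernel \<Phi>)"
    and "continuous_on UNIV \<Phi>"
    and "integrable lborel \<Phi>"
    and "C1 > 0" and "C2 > 0" and "\<alpha> > real CARD('d) / 2"
    and "\<And>\<xi>. fourier_transform \<Phi> \<xi> \<in> \<real>"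
    and "\<And>\<xi>. C1 * (1 + (norm \<xi>)\<^sup>2) powr (- \<alpha>) \<le> Re (fourier_transform \<Phi> \<xi>)"
    and "\<And>\<xi>. Re (fourier_transform \<Phi> \<xi>) \<le> C2 * (1 + (norm \<xi>)\<^sup>2) powr (- \<alpha>)"
    and "m_constant m n x y"
  shows "filterlim (cv_objective \<Phi> m n x y) at_bot at_top
       \<and> argmin_is_infinity (cv_objective \<Phi> m n x y)"
proof -
  note n = assms(1) and x = assms(2) and pd = assms(3) and cont = assms(4) and int = assms(5) and y = assms(12)
  have \<alpha>: "\<alpha> \<ge> 0" using assms(8) of_nat_0_le_iff[of "CARD('d)"] by linarith
  define V where "V = (\<lambda>l k. (loo_sd (scaled_kernel \<Phi> l) n x k (x k))\<^sup>2)"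
  define E where "E = (\<lambda>l k. ((y k - loo_mean m (scaled_kernel \<Phi> l) n x y k (x k)) / loo_sd (scaled_kernel \<Phi> l) n x k (x k))\<^sup>2)"
  have cv: "cv_objective \<Phi> m n x y l = (\<Sum>k<n. E l k + ln (V l k))" for l
    by (simp add: cv_objective_def E_def V_def)
  have Vpos: "V l k > 0" if "l > 0" "k < n" for l k
    unfolding V_def using loo_sd_sq_bounds(1)[OF pd that(1) x that(2)] .
  have lim: "filterlim (cv_objective \<Phi> m n x y) at_bot at_top"
    unfolding filterlim_at_bot
  proof
    fix Z :: real
    obtain A R where A: "\<And>l k. R \<le> l \<Longrightarrow> k < n \<Longrightarrow> E l k \<le> A"
      using loo_standardized_residual_bound[OF pd int cont assms(9,10,6) \<alpha> x y] unfolding E_def by blast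
    \<comment> \<open>Chosen so that \<open>n * (A + ln \<epsilon>) = Z\<close>.\<close>
    define \<epsilon> where "\<epsilon> = exp (Z / real n - A)"
    have "\<forall>\<^sub>F l in at_top. V l k < \<epsilon>" if "k < n" for k
      unfolding V_def by (rule order_tendstoD(2)[OF loo_sd_sq_tendsto_0[OF pd cont x n that]]) (simp add: \<epsilon>_def)
    then have "\<forall>\<^sub>F l in at_top. \<forall>k\<in>{..<n}. V l k < \<epsilon>"
      by (intro eventually_ball_finite) auto
    then show "\<forall>\<^sub>F l in at_top. cv_objective \<Phi> m n x y l \<le> Z"
      using eventually_ge_at_top[of R] eventually_gt_at_top[of 0]
    proof eventually_elim
      case (elim l)
      have "E l k + ln (V l k) \<le> Z / real n" if k: "k < n" for k
      proof -
        have "ln (V l k) \<le> ln \<epsilon>" using elim(1) k Vpos[OF elim(3) k] by (intro ln_mono) (auto intro: less_imp_le)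
        then show ?thesis using A[OF elim(2) k] by (simp add: \<epsilon>_def)
      qed
      then have "(\<Sum>k<n. E l k + ln (V l k)) \<le> (\<Sum>k<n. Z / real n)" by (intro sum_mono) auto
      also have "\<dots> = Z" using n by simp
      finally show ?case by (simp add: cv)
    qed
  qed
  have "\<exists>c. \<forall>l. 0 < l \<longrightarrow> l \<le> M \<longrightarrow> c \<le> cv_objective \<Phi> m n x y l" if M: "M > 0" for M
  proof -
    obtain \<epsilon> where \<epsilon>: "\<epsilon> > 0" and V: "\<And>l k. 0 < l \<Longrightarrow> l \<le> M \<Longrightarrow> k < n \<Longrightarrow> \<epsilon> \<le> V l k"
      using loo_sd_sq_lower_bound[OF pd int cont assms(9,10,6) \<alpha> x M] unfolding V_def by blast
    have "(\<Sum>k<n. ln \<epsilon>) \<le> cv_objective \<Phi> m n x y l" if l: "0 < l" "l \<le> M" for l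
      unfolding cv
    proof (rule sum_mono)
      fix k assume "k \<in> {..<n}"
      then have "ln \<epsilon> \<le> ln (V l k)" using \<epsilon> V[OF l] by (intro ln_mono) auto
      moreover have "0 \<le> E l k" by (simp add: E_def)
      ultimately show "ln \<epsilon> \<le> E l k + ln (V l k)" by simp
    qed
    then show ?thesis by blast
  qed
  with lim show ?thesis by (auto intro: argmin_is_infinityI)
qed

end
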